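(* The fragments $\Sigma_{2,0,1}^{\mathfrak{D}}$, $\Sigma_{1,0,1}^{\mathfrak{B}}$ and $\Sigma_{1,3,2}^{\mathfrak{F}}$ are undecidable. That is: there is no algorithm deciding whether a given $\Sigma$-sentence with 2 unbounded existential, 0 bounded existential and 1 bounded universal quantifiers is true in $\mathfrak{D}$; none deciding whether a given $\Sigma$-sentence with 1 unbounded existential, 0 bounded existential and 1 bounded universal quantifier is true in $\mathfrak{B}$; and none deciding whether a given $\Sigma$-sentence with 1 unbounded existential, 3 bounded existential and 2 bounded universal quantifiers is true in $\mathfrak{F}$.
   Context: Bit strings are elements of $\{\mathbf{0},\mathbf{1}\}^*$; $\varepsilon$ is the empty string, $|\alpha|$ the length. The language $\mathcal{L}_{BT}$ has constant symbols $e,0,1$, binary function symbol $\circ$, and binary relation symbol $\sqsubseteq$. The structures $\mathfrak{B},\mathfrak{D},\mathfrak{F}$ all have universe $\{\mathbf{0},\mathbf{1}\}^*$, interpret $e,0,1$ as $\varepsilon,\mathbf{0},\mathbf{1}$ and $\circ$ as concatenation; $\alpha\sqsubseteq\beta$ is interpreted in $\mathfrak{B}$ as "$\alpha$ is a substring of $\beta$", in $\mathfrak{D}$ as "$\alpha$ is a prefix of $\beta$", and in $\mathfrak{F}$ as $|\alpha|\le|\beta|$. $(\exists x\sqsubseteq t)\phi$ abbreviates $\exists x[x\sqsubseteq t\wedge\phi]$, $(\forall x\sqsubseteq t)\phi$ abbreviates $\forall x[x\sqsubseteq t\to\phi]$. $\Sigma$-formulas: $s\sqsubseteq t$, $\neg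 s\sqsubseteq t$, $s=t$, $\neg s=t$ (terms $s,t$) are $\Sigma$-formulas; they are closed under $\wedge,\vee$, and under $(\exists x\sqsubseteq t)$, $(\forall x\sqsubseteq t)$ and $\exists x$ where $x$ does not occur in $t$. A $\Sigma$-formula is a $\Sigma_{n,m,k}$-formula if it contains $n$ unbounded existential quantifiers, $m$ bounded existential quantifiers and $k$ bounded universal quantifiers; $\Sigma_{n,m,k}^{\mathfrak{A}}$ denotes the set of $\Sigma_{n,m,k}$-sentences true in $\mathfrak{A}$. *)

theory Defs
  imports Main "HOL-Library.Sublist" "HOL-Library.Nat_Bijection"
begin

section \<open>Bit strings and structures for the language of concatenation theory\<close>

text \<open>The bits \<open>\<zero>\<close> and \<open>\<one>\<close> are \<^const>\<open>False\<close> and \<^const>\<open>True\<close>.\<close>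

type_synonym bits = "bool list"

record 'a bt_structure =
  i_e :: 'a
  i_0 :: 'a
  i_1 :: 'a
  i_conc :: "'a \<Rightarrow> 'a \<Rightarrow> 'a"
  i_le :: "'a \<Rightarrow> 'a \<Rightarrow> bool"

definition bits_structure :: "(bits \<Rightarrow> bits \<Rightarrow> bool) \<Rightarrow> bits bt_structure" where
  "bits_structure R = \<lparr>i_e = [], i_0 = [False], i_1 = [True], i_conc = (@), i_le = R\<rparr>"

text \<open>\<^const>\<open>sublist\<close> is the contiguous-substring relation.\<close>

definition struct_B :: "bits bt_structure" where
  "struct_B = bits_structure sublist"

definition struct_D :: "bits bt_structure" where
  "struct_D = bits_structure prefix"

definition struct_F :: "bits bt_structure" where
  "struct_F = bits_structure (\<lambda>\<alpha> \<beta>. length \<alpha> \<le> length \<beta>)"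


section \<open>\<open>\<Sigma>\<close>-formulas\<close>

datatype trm = Var nat | ConstE | Const0 | Const1 | Conc trm trm

text \<open>
  Bounded quantifiers have constructors of their own, so that the number of quantifiers of each
  kind is determined by the formula; their semantics is that of the formulas
  \<open>\<exists>x[x \<sqsubseteq> t \<and> \<phi>]\<close> and \<open>\<forall>x[x \<sqsubseteq> t \<longrightarrow> \<phi>]\<close> which they abbreviate. The side condition on the
  bounding term is imposed by \<open>sigma_formula\<close> below.
\<close>

datatype fm =
    Le trm trm
  | NotLe trm trm
  | Eq trm trm
  | NotEq trm trm
  | And fm fm
  | Or fm fm
  | BEx nat trm fm
  | BAll nat trm fm
  | Ex nat fm

primrec trm_vars :: "trm \<Rightarrow> nat set" where
  "trm_vars (Var x) = {x}"
| "trm_vars ConstE = {}"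
| "trm_vars Const0 = {}"
| "trm_vars Const1 = {}"
| "trm_vars (Conc s t) = trm_vars s \<union> trm_vars t"

primrec sigma_formula :: "fm \<Rightarrow> bool" where
  "sigma_formula (Le s t) \<longleftrightarrow> True"
| "sigma_formula (NotLe s t) \<longleftrightarrow> True"
| "sigma_formula (Eq s t) \<longleftrightarrow> True"
| "sigma_formula (NotEq s t) \<longleftrightarrow> True"
| "sigma_formula (And \<phi> \<psi>) \<longleftrightarrow> sigma_formula \<phi> \<and> sigma_formula \<psi>"
| "sigma_formula (Or \<phi> \<psi>) \<longleftrightarrow> sigma_formula \<phi> \<and> sigma_formula \<psi>"
| "sigma_formula (BEx x t \<phi>) \<longleftrightarrow> x \<notin> trm_vars t \<and> sigma_formula \<phi>"
| "sigma_formula (BAll x t \<phi>) \<longleftrightarrow> x \<notin> trm_vars t \<and> sigma_formula \<phi>"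
| "sigma_formula (Ex x \<phi>) \<longleftrightarrow> sigma_formula \<phi>"

primrec free_vars :: "fm \<Rightarrow> nat set" where
  "free_vars (Le s t) = trm_vars s \<union> trm_vars t"
| "free_vars (NotLe s t) = trm_vars s \<union> trm_vars t"
| "free_vars (Eq s t) = trm_vars s \<union> trm_vars t"
| "free_vars (NotEq s t) = trm_vars s \<union> trm_vars t"
| "free_vars (And \<phi> \<psi>) = free_vars \<phi> \<union> free_vars \<psi>"
| "free_vars (Or \<phi> \<psi>) = free_vars \<phi> \<union> free_vars \<psi>"
| "free_vars (BEx x t \<phi>) = (trm_vars t \<union> free_vars \<phi>) - {x}"
| "free_vars (BAll x t \<phi>) = (trm_vars t \<union> free_vars \<phi>) - {x}"
| "free_vars (Ex x \<phi>) = free_vars \<phi> - {x}"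

primrec count_ex :: "fm \<Rightarrow> nat" where
  "count_ex (Le s t) = 0"
| "count_ex (NotLe s t) = 0"
| "count_ex (Eq s t) = 0"
| "count_ex (NotEq s t) = 0"
| "count_ex (And \<phi> \<psi>) = count_ex \<phi> + count_ex \<psi>"
| "count_ex (Or \<phi> \<psi>) = count_ex \<phi> + count_ex \<psi>"
| "count_ex (BEx x t \<phi>) = count_ex \<phi>"
| "count_ex (BAll x t \<phi>) = count_ex \<phi>"
| "count_ex (Ex x \<phi>) = Suc (count_ex \<phi>)"

primrec count_bex :: "fm \<Rightarrow> nat" where
  "count_bex (Le s t) = 0"
| "count_bex (NotLe s t) = 0"
| "count_bex (Eq s t) = 0"
| "count_bex (NotEq s t) = 0"
| "count_bex (And \<phi> \<psi>) = count_bex \<phi> + count_bex \<psi>"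
| "count_bex (Or \<phi> \<psi>) = count_bex \<phi> + count_bex \<psi>"
| "count_bex (BEx x t \<phi>) = Suc (count_bex \<phi>)"
| "count_bex (BAll x t \<phi>) = count_bex \<phi>"
| "count_bex (Ex x \<phi>) = count_bex \<phi>"

primrec count_ball :: "fm \<Rightarrow> nat" where
  "count_ball (Le s t) = 0"
| "count_ball (NotLe s t) = 0"
| "count_ball (Eq s t) = 0"
| "count_ball (NotEq s t) = 0"
| "count_ball (And \<phi> \<psi>) = count_ball \<phi> + count_ball \<psi>"
| "count_ball (Or \<phi> \<psi>) = count_ball \<phi> + count_ball \<psi>"
| "count_ball (BEx x t \<phi>) = count_ball \<phi>"
| "count_ball (BAll x t \<phi>) = Suc (count_ball \<phi>)"
| "count_ball (Ex x \<phi>) = count_ball \<phi>"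

primrec trm_val :: "'a bt_structure \<Rightarrow> (nat \<Rightarrow> 'a) \<Rightarrow> trm \<Rightarrow> 'a" where
  "trm_val \<AA> \<sigma> (Var x) = \<sigma> x"
| "trm_val \<AA> \<sigma> ConstE = i_e \<AA>"
| "trm_val \<AA> \<sigma> Const0 = i_0 \<AA>"
| "trm_val \<AA> \<sigma> Const1 = i_1 \<AA>"
| "trm_val \<AA> \<sigma> (Conc s t) = i_conc \<AA> (trm_val \<AA> \<sigma> s) (trm_val \<AA> \<sigma> t)"

primrec sat :: "'a bt_structure \<Rightarrow> (nat \<Rightarrow> 'a) \<Rightarrow> fm \<Rightarrow> bool" where
  "sat \<AA> \<sigma> (Le s t) \<longleftrightarrow> i_le \<AA> (trm_val \<AA> \<sigma> s) (trm_val \<AA> \<sigma> t)"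
| "sat \<AA> \<sigma> (NotLe s t) \<longleftrightarrow> \<not> i_le \<AA> (trm_val \<AA> \<sigma> s) (trm_val \<AA> \<sigma> t)"
| "sat \<AA> \<sigma> (Eq s t) \<longleftrightarrow> trm_val \<AA> \<sigma> s = trm_val \<AA> \<sigma> t"
| "sat \<AA> \<sigma> (NotEq s t) \<longleftrightarrow> trm_val \<AA> \<sigma> s \<noteq> trm_val \<AA> \<sigma> t"
| "sat \<AA> \<sigma> (And \<phi> \<psi>) \<longleftrightarrow> sat \<AA> \<sigma> \<phi> \<and> sat \<AA> \<sigma> \<psi>"
| "sat \<AA> \<sigma> (Or \<phi> \<psi>) \<longleftrightarrow> sat \<AA> \<sigma> \<phi> \<or> sat \<AA> \<sigma> \<psi>"
| "sat \<AA> \<sigma> (BEx x t \<phi>) \<longleftrightarrow>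
     (\<exists>a. i_le \<AA> a (trm_val \<AA> (\<sigma>(x := a)) t) \<and> sat \<AA> (\<sigma>(x := a)) \<phi>)"
| "sat \<AA> \<sigma> (BAll x t \<phi>) \<longleftrightarrow>
     (\<forall>a. i_le \<AA> a (trm_val \<AA> (\<sigma>(x := a)) t) \<longrightarrow> sat \<AA> (\<sigma>(x := a)) \<phi>)"
| "sat \<AA> \<sigma> (Ex x \<phi>) \<longleftrightarrow> (\<exists>a. sat \<AA> (\<sigma>(x := a)) \<phi>)"

definition true_in :: "'a bt_structure \<Rightarrow> fm \<Rightarrow> bool" where
  "true_in \<AA> \<phi> \<longleftrightarrow> (\<forall>\<sigma>. sat \<AA> \<sigma> \<phi>)"

definition Sigma_sentences :: "nat \<Rightarrow> nat \<Rightarrow> nat \<Rightarrow> fm set" where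
  "Sigma_sentences n m k =
     {\<phi>. sigma_formula \<phi> \<and> free_vars \<phi> = {} \<and>
         count_ex \<phi> = n \<and> count_bex \<phi> = m \<and> count_ball \<phi> = k}"

definition Sigma_true :: "nat \<Rightarrow> nat \<Rightarrow> nat \<Rightarrow> 'a bt_structure \<Rightarrow> fm set" where
  "Sigma_true n m k \<AA> = {\<phi> \<in> Sigma_sentences n m k. true_in \<AA> \<phi>}"


section \<open>Partial recursive functions\<close>

text \<open>
  Kleene's partial recursive functions. Arities are left implicit: a program run on argument
  lists of length \<open>k\<close> denotes a \<open>k\<close>-ary partial function, undefined where no rule applies.
  \<open>PrimRec\<close> recurses on the first argument, and \<open>Mu\<close> searches for a new first argument.
\<close>

datatype recf =
    Zero
  | Succ
  | Proj nat
  | Comp recf "recf list"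
  | PrimRec recf recf
  | Mu recf

inductive rec_eval :: "recf \<Rightarrow> nat list \<Rightarrow> nat \<Rightarrow> bool" where
  rec_zero: "rec_eval Zero xs 0"
| rec_succ: "rec_eval Succ [x] (Suc x)"
| rec_proj: "i < length xs \<Longrightarrow> rec_eval (Proj i) xs (xs ! i)"
| rec_comp: "length ys = length gs \<Longrightarrow> \<forall>i<length gs. rec_eval (gs ! i) xs (ys ! i) \<Longrightarrow>
    rec_eval f ys z \<Longrightarrow> rec_eval (Comp f gs) xs z"
| rec_prim_0: "rec_eval f xs z \<Longrightarrow> rec_eval (PrimRec f g) (0 # xs) z"
| rec_prim_Suc: "rec_eval (PrimRec f g) (n # xs) r \<Longrightarrow> rec_eval g (n # r # xs) z \<Longrightarrow>
    rec_eval (PrimRec f g) (Suc n # xs) z"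
| rec_mu: "rec_eval f (n # xs) 0 \<Longrightarrow> \<forall>i<n. \<exists>k. rec_eval f (i # xs) (Suc k) \<Longrightarrow>
    rec_eval (Mu f) xs n"

inductive_cases rec_zeroE: "rec_eval Zero xs z"
inductive_cases rec_succE: "rec_eval Succ xs z"
inductive_cases rec_projE: "rec_eval (Proj i) xs z"
inductive_cases rec_compE: "rec_eval (Comp f gs) xs z"
inductive_cases rec_prim_0E: "rec_eval (PrimRec f g) (0 # xs) z"
inductive_cases rec_prim_SucE: "rec_eval (PrimRec f g) (Suc n # xs) z"
inductive_cases rec_muE: "rec_eval (Mu f) xs z"

lemma rec_eval_deterministic:
  assumes "rec_eval f xs y" and "rec_eval f xs z"
  shows "y = z"
  using assms
proof (induction arbitrary: z rule: rec_eval.induct)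
  case (rec_zero xs)
  then show ?case by (rule rec_zeroE) simp
next
  case (rec_succ x)
  then show ?case by (rule rec_succE) simp
next
  case (rec_proj i xs)
  from rec_proj.prems show ?case by (rule rec_projE) simp
next
  case (rec_comp ys gs xs f y)
  from rec_comp.prems obtain zs where zs: "length zs = length gs"
      "\<forall>i<length gs. rec_eval (gs ! i) xs (zs ! i)" "rec_eval f zs z"
    by (rule rec_compE)
  have "ys = zs"
  proof (rule nth_equalityI)
    show "length ys = length zs" using rec_comp.hyps(1) zs(1) by simp
    show "ys ! i = zs ! i" if "i < length ys" for i
      using that zs(2) rec_comp.hyps(1) rec_comp.IH(1) by metis
  qed
  with zs(3) rec_comp.IH(2) show ?case by blast
next
  case (rec_prim_0 f xs y g)
  from rec_prim_0.prems have "rec_eval f xs z" by (rule rec_prim_0E)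
  then show ?case by (rule rec_prim_0.IH)
next
  case (rec_prim_Suc f g n xs r y)
  from rec_prim_Suc.prems obtain r' where
      "rec_eval (PrimRec f g) (n # xs) r'" "rec_eval g (n # r' # xs) z"
    by (rule rec_prim_SucE)
  with rec_prim_Suc.IH show ?case by blast
next
  case (rec_mu f n xs)
  from rec_mu.prems have z: "rec_eval f (z # xs) 0" "\<forall>i<z. \<exists>k. rec_eval f (i # xs) (Suc k)"
    by (blast elim: rec_muE)+
  have "\<not> n < z"
  proof
    assume "n < z"
    with z(2) obtain k where "rec_eval f (n # xs) (Suc k)" by blast
    with rec_mu.IH(1) have "0 = Suc k" by blast
    then show False by simp
  qed
  moreover have "\<not> z < n"
  proof
    assume "z < n"
    with rec_mu.IH(2) obtain k where "\<forall>w. rec_eval f (z # xs) w \<longrightarrow> Suc k = w" by blast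
    with z(1) have "Suc k = 0" by blast
    then show False by simp
  qed
  ultimately show ?case by simp
qed


section \<open>Goedel numbering and decidability\<close>

primrec trm_code :: "trm \<Rightarrow> nat" where
  "trm_code (Var x) = prod_encode (0, x)"
| "trm_code ConstE = prod_encode (1, 0)"
| "trm_code Const0 = prod_encode (2, 0)"
| "trm_code Const1 = prod_encode (3, 0)"
| "trm_code (Conc s t) = prod_encode (4, prod_encode (trm_code s, trm_code t))"

primrec fm_code :: "fm \<Rightarrow> nat" where
  "fm_code (Le s t) = prod_encode (0, prod_encode (trm_code s, trm_code t))"
| "fm_code (NotLe s t) = prod_encode (1, prod_encode (trm_code s, trm_code t))"
| "fm_code (Eq s t) = prod_encode (2, prod_encode (trm_code s, trm_code t))"
| "fm_code (NotEq s t) = prod_encode (3, prod_encode (trm_code s, trm_code t))"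
| "fm_code (And \<phi> \<psi>) = prod_encode (4, prod_encode (fm_code \<phi>, fm_code \<psi>))"
| "fm_code (Or \<phi> \<psi>) = prod_encode (5, prod_encode (fm_code \<phi>, fm_code \<psi>))"
| "fm_code (BEx x t \<phi>) = prod_encode (6, prod_encode (x, prod_encode (trm_code t, fm_code \<phi>)))"
| "fm_code (BAll x t \<phi>) = prod_encode (7, prod_encode (x, prod_encode (trm_code t, fm_code \<phi>)))"
| "fm_code (Ex x \<phi>) = prod_encode (8, prod_encode (x, fm_code \<phi>))"

lemma trm_code_eq_iff [simp]: "trm_code s = trm_code t \<longleftrightarrow> s = t"
proof (induction s arbitrary: t)
  case (Var x) show ?case by (cases t) auto
next
  case ConstE show ?case by (cases t) auto
next
  case Const0 show ?case by (cases t) auto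
next
  case Const1 show ?case by (cases t) auto
next
  case (Conc s1 s2) then show ?case by (cases t) auto
qed

lemma fm_code_eq_iff [simp]: "fm_code \<phi> = fm_code \<psi> \<longleftrightarrow> \<phi> = \<psi>"
proof (induction \<phi> arbitrary: \<psi>)
  case (Le s t) show ?case by (cases \<psi>) auto
next
  case (NotLe s t) show ?case by (cases \<psi>) auto
next
  case (Eq s t) show ?case by (cases \<psi>) auto
next
  case (NotEq s t) show ?case by (cases \<psi>) auto
next
  case (And \<phi>1 \<phi>2) then show ?case by (cases \<psi>) auto
next
  case (Or \<phi>1 \<phi>2) then show ?case by (cases \<psi>) auto
next
  case (BEx x t \<phi>) then show ?case by (cases \<psi>) auto
next
  case (BAll x t \<phi>) then show ?case by (cases \<psi>) auto
next
  case (Ex x \<phi>) then show ?case by (cases \<psi>) auto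
qed

text \<open>
  Membership in \<open>A\<close> of given elements of \<open>S\<close> is decidable. The algorithm need not halt on inputs
  outside \<open>S\<close>, so this is implied by decidability of \<open>A\<close> among all formulas, and its negation
  is the stronger undecidability claim.
\<close>

definition decidable_within :: "fm set \<Rightarrow> fm set \<Rightarrow> bool" where
  "decidable_within S A \<longleftrightarrow>
     (\<exists>f. \<forall>\<phi>\<in>S. rec_eval f [fm_code \<phi>] (if \<phi> \<in> A then 1 else 0))"

lemma decidable_within_mono:
  "decidable_within S A \<Longrightarrow> S' \<subseteq> S \<Longrightarrow> decidable_within S' A"
  unfolding decidable_within_def by blast

definition undecidable_fragment :: "nat \<Rightarrow> nat \<Rightarrow> nat \<Rightarrow> 'a bt_structure \<Rightarrow> bool" where
  "undecidable_fragment n m k \<AA> \<longleftrightarrow>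
     \<not> decidable_within (Sigma_sentences n m k) (Sigma_true n m k \<AA>)"

end

theory Submission
  imports Defs "HOL-Computational_Algebra.Primes" "HOL-Library.Infinite_Set"
begin

text \<open>
  Every partial recursive function is computed by a program on counters. Coding the counters as
  exponents of primes turns the program into a finite system of rules
  \<open>(q, k m + j) \<rightarrow> (q', k' m + j')\<close> on a state and one number. Writing
  \<open>(q, N)\<close> as the word \<open>11 0\<^sup>q\<^sup>+\<^sup>1 1 0\<^sup>N\<close>, a halting run becomes a single word \<open>u\<close>, and a rule
  relates words that depend on one block of zeros \<open>w = 0\<^sup>m\<close> only. In \<open>\<DD>\<close> the formula asks, for each
  prefix \<open>v\<close> of \<open>u\<close> at which a configuration begins, for some \<open>w\<close> matching a rule there; this
  second unbounded quantifier stands inside the bounded one. In \<open>\<FF>\<close> prefixes are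
  expressed by equations, and the remainders are bounded by \<open>|u|\<close>. In \<open>\<BB>\<close> the block \<open>w\<close> itself is the
  universally quantified substring, and \<open>u\<close> contains, with each configuration, its successor. This
  excludes infinite runs since the number \<open>N\<close> is made to grow at every step.
\<close>

section \<open>Counter programs\<close>

text \<open>The obstacle is the quantifier budget. Once \<open>u\<close> and a position
  \<open>v\<close> in it are quantified, \<open>struct_D\<close> has one variable left, so
  everything else about a step must be determined by a single block of zeros: hence one number in
  place of several counters, and linear maps on residue classes in place of arithmetic. The choice
  among finitely many rules costs only connectives. In \<open>struct_B\<close> the universal
  variable is already spent on the block, so no variable is left for a position and adjacency of
  configurations cannot be stated; closure of \<open>u\<close> under the rules takes its place. The
  last block of a configuration is delimited by the one with which the next configuration begins, so
  a history ends in an extra one. The input appears as 2 to the power n because register 0 is coded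
  by the prime 2. It enters the opening conjunct of the sentence alone; the rest depends only on the
  program, and this allows the program to be run on the code of that rest.\<close>

datatype 'r cmd = Inc 'r | Loop 'r "'r cmd list"

text \<open>
  The program argument is everything that remains to be executed, so that a derivation of
  \<open>exec\<close> is a run of a machine whose control states are the remaining programs.
\<close>

inductive exec :: "'r cmd list \<Rightarrow> ('r \<Rightarrow> nat) \<Rightarrow> ('r \<Rightarrow> nat) \<Rightarrow> bool" where
  exec_Nil: "exec [] \<rho> \<rho>"
| exec_Inc: "exec K (\<rho>(r := Suc (\<rho> r))) \<rho>' \<Longrightarrow> exec (Inc r # K) \<rho> \<rho>'"
| exec_Loop_0: "\<rho> r = 0 \<Longrightarrow> exec K \<rho> \<rho>' \<Longrightarrow> exec (Loop r b # K) \<rho> \<rho>'"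
| exec_Loop_Suc: "\<rho> r = Suc n \<Longrightarrow> exec (b @ Loop r b # K) (\<rho>(r := n)) \<rho>' \<Longrightarrow>
    exec (Loop r b # K) \<rho> \<rho>'"

lemma exec_Nil_iff [simp]: "exec [] \<rho> \<rho>' \<longleftrightarrow> \<rho>' = \<rho>"
  by (auto elim: exec.cases intro: exec_Nil)

lemma exec_Inc_iff [simp]: "exec (Inc r # K) \<rho> \<rho>' \<longleftrightarrow> exec K (\<rho>(r := Suc (\<rho> r))) \<rho>'"
  by (auto elim: exec.cases intro: exec_Inc)

lemma exec_Loop_0_iff: "\<rho> r = 0 \<Longrightarrow> exec (Loop r b # K) \<rho> \<rho>' \<longleftrightarrow> exec K \<rho> \<rho>'"
  by (auto elim: exec.cases intro: exec_Loop_0)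

lemma exec_Loop_Suc_iff:
  "\<rho> r = Suc n \<Longrightarrow> exec (Loop r b # K) \<rho> \<rho>' \<longleftrightarrow> exec (b @ Loop r b # K) (\<rho>(r := n)) \<rho>'"
  by (auto elim: exec.cases intro: exec_Loop_Suc)

lemma exec_append: "exec (P @ Q) \<rho> \<rho>' \<longleftrightarrow> (\<exists>\<rho>1. exec P \<rho> \<rho>1 \<and> exec Q \<rho>1 \<rho>')"
proof
  assume "exec (P @ Q) \<rho> \<rho>'"
  then show "\<exists>\<rho>1. exec P \<rho> \<rho>1 \<and> exec Q \<rho>1 \<rho>'"
  proof (induction "P @ Q" \<rho> \<rho>' arbitrary: P rule: exec.induct)
    case (exec_Inc K \<rho> r \<rho>')
    then show ?case by (cases P) auto
  next
    case (exec_Loop_0 \<rho> r K \<rho>' b)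
    then show ?case
      by (cases P) (auto simp: exec_Loop_0_iff)
  next
    case (exec_Loop_Suc \<rho> r n b K \<rho>')
    show ?case
    proof (cases P)
      case Nil
      with exec_Loop_Suc show ?thesis by (auto simp: exec_Loop_Suc_iff)
    next
      case (Cons c P')
      with exec_Loop_Suc.hyps(4) have "c = Loop r b" "b @ Loop r b # K = (b @ Loop r b # P') @ Q"
        by auto
      with exec_Loop_Suc.hyps(1,3) Cons show ?thesis by (metis exec_Loop_Suc_iff)
    qed
  qed simp
next
  assume "\<exists>\<rho>1. exec P \<rho> \<rho>1 \<and> exec Q \<rho>1 \<rho>'"
  then obtain \<rho>1 where "exec P \<rho> \<rho>1" "exec Q \<rho>1 \<rho>'" by blast
  then show "exec (P @ Q) \<rho> \<rho>'"
    by (induction rule: exec.induct) (auto simp: exec_Loop_0_iff exec_Loop_Suc_iff)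
qed

lemma exec_clear: "exec (Loop r [] # K) \<rho> \<rho>' \<longleftrightarrow> exec K (\<rho>(r := 0)) \<rho>'"
proof (induction "\<rho> r" arbitrary: \<rho>)
  case 0
  moreover from 0 have "\<rho>(r := 0) = \<rho>" by auto
  ultimately show ?case by (simp add: exec_Loop_0_iff)
next
  case (Suc n)
  from Suc(1)[of "\<rho>(r := n)"] Suc(2) show ?case
    by (simp add: exec_Loop_Suc_iff[of \<rho> r n])
qed

lemma exec_move:
  assumes "a \<noteq> c"
  shows "exec (Loop a [Inc c] # K) \<rho> \<rho>' \<longleftrightarrow> exec K (\<rho>(a := 0, c := \<rho> c + \<rho> a)) \<rho>'"
proof (induction "\<rho> a" arbitrary: \<rho>)
  case 0
  then have "\<rho>(a := 0, c := \<rho> c + \<rho> a) = \<rho>" by auto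
  then show ?case by (simp only: exec_Loop_0_iff[of \<rho> a, OF 0[symmetric]])
next
  case (Suc n)
  from assms have "(\<rho>(a := n, c := Suc (\<rho> c)))(a := 0, c := Suc (\<rho> c) + n) =
      \<rho>(a := 0, c := \<rho> c + Suc n)" by auto
  with Suc(1)[of "\<rho>(a := n, c := Suc (\<rho> c))"] Suc(2)[symmetric] assms show ?case
    by (simp add: exec_Loop_Suc_iff[of \<rho> a n])
qed

lemma exec_move2:
  assumes "a \<noteq> c" "a \<noteq> t" "c \<noteq> t"
  shows "exec (Loop a [Inc c, Inc t] # K) \<rho> \<rho>' \<longleftrightarrow>
    exec K (\<rho>(a := 0, c := \<rho> c + \<rho> a, t := \<rho> t + \<rho> a)) \<rho>'"
proof (induction "\<rho> a" arbitrary: \<rho>)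
  case 0
  then have "\<rho>(a := 0, c := \<rho> c + \<rho> a, t := \<rho> t + \<rho> a) = \<rho>" by auto
  then show ?case by (simp only: exec_Loop_0_iff[of \<rho> a, OF 0[symmetric]])
next
  case (Suc n)
  from assms have "(\<rho>(a := n, c := Suc (\<rho> c), t := Suc (\<rho> t)))
     (a := 0, c := Suc (\<rho> c) + n, t := Suc (\<rho> t) + n) = \<rho>(a := 0, c := \<rho> c + Suc n, t := \<rho> t + Suc n)"
    by auto
  with Suc(1)[of "\<rho>(a := n, c := Suc (\<rho> c), t := Suc (\<rho> t))"] Suc(2) assms show ?case
    by (simp add: exec_Loop_Suc_iff[of \<rho> a n])
qed

text \<open>A loop consumes the register it tests, so copying \<open>a\<close> needs a second loop
  that restores it from the scratch register \<open>t\<close>.\<close>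

lemma exec_copy:
  assumes "a \<noteq> c" "a \<noteq> t" "c \<noteq> t" "\<rho> t = 0"
  shows "exec (Loop a [Inc c, Inc t] # Loop t [Inc a] # K) \<rho> \<rho>' \<longleftrightarrow>
    exec K (\<rho>(c := \<rho> c + \<rho> a)) \<rho>'"
proof -
  let ?\<rho> = "\<rho>(a := 0, c := \<rho> c + \<rho> a, t := \<rho> t + \<rho> a)"
  from assms have "?\<rho>(t := 0, a := ?\<rho> a + ?\<rho> t) = \<rho>(c := \<rho> c + \<rho> a)" by auto
  moreover have "exec (Loop a [Inc c, Inc t] # Loop t [Inc a] # K) \<rho> \<rho>' \<longleftrightarrow>
      exec K (?\<rho>(t := 0, a := ?\<rho> a + ?\<rho> t)) \<rho>'"
    using assms(2) by (subst exec_move2[OF assms(1-3)]) (subst exec_move, auto)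
  ultimately show ?thesis by simp
qed

lemma exec_clear_list:
  "exec (map (\<lambda>r. Loop r []) rs) \<rho> \<rho>' \<longleftrightarrow> \<rho>' = (\<lambda>r. if r \<in> set rs then 0 else \<rho> r)"
proof (induction rs arbitrary: \<rho>)
  case (Cons r rs)
  have "(\<lambda>x. if x \<in> set rs then 0 else (\<rho>(r := 0)) x) =
      (\<lambda>x. if x \<in> set (r # rs) then 0 else \<rho> x)" by auto
  with Cons show ?case by (simp add: exec_clear)
qed auto

text \<open>Whenever control is at the loop, \<open>r\<close> is positive; this strengthening is
  preserved by both remaining programs and so excludes a finite derivation.\<close>

lemma not_exec_diverge: "\<not> exec (Inc r # Loop r [Inc r] # K) \<rho> \<rho>'"
proof
  have "exec L \<rho> \<rho>' \<Longrightarrow> L = Loop r [Inc r] # K \<or> L = Inc r # Loop r [Inc r] # K \<Longrightarrow>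
     (L = Loop r [Inc r] # K \<Longrightarrow> \<rho> r > 0) \<Longrightarrow> False" for L \<rho> \<rho>'
    by (induction rule: exec.induct) auto
  moreover assume "exec (Inc r # Loop r [Inc r] # K) \<rho> \<rho>'"
  ultimately show False by blast
qed

section \<open>Compiling partial recursive functions into counter programs\<close>

definition frame :: "nat list \<Rightarrow> nat \<Rightarrow> nat \<Rightarrow> bool" where
  "frame as out b \<longleftrightarrow> (\<forall>a\<in>set as. a < b) \<and> out < b \<and> out \<notin> set as"

text \<open>The registers from \<open>b\<close> onwards are scratch space, clean before and after the run.\<close>

definition implements :: "nat cmd list \<Rightarrow> recf \<Rightarrow> nat list \<Rightarrow> nat \<Rightarrow> nat \<Rightarrow> bool" where
  "implements P f as out b \<longleftrightarrow> (\<forall>\<rho> \<rho>'. \<rho> out = 0 \<longrightarrow> (\<forall>r\<ge>b. \<rho> r = 0) \<longrightarrow>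
     (exec P \<rho> \<rho>' \<longleftrightarrow> (\<exists>z. rec_eval f (map \<rho> as) z \<and> \<rho>' = \<rho>(out := z))))"

lemma implementsD:
  "implements P f as out b \<Longrightarrow> \<rho> out = 0 \<Longrightarrow> \<forall>r\<ge>b. \<rho> r = 0 \<Longrightarrow>
    exec P \<rho> \<rho>' \<longleftrightarrow> (\<exists>z. rec_eval f (map \<rho> as) z \<and> \<rho>' = \<rho>(out := z))"
  unfolding implements_def by blast

definition implementable :: "recf \<Rightarrow> bool" where
  "implementable f \<longleftrightarrow> (\<forall>as out b. frame as out b \<longrightarrow> (\<exists>P. implements P f as out b))"

text \<open>Arities are implicit, so a function applied to a list of the wrong length is undefined
  there, and its implementation has to diverge.\<close>

lemma implements_nowhere_defined:
  assumes "\<And>xs z. length xs = length as \<Longrightarrow> \<not> rec_eval f xs z"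
  shows "\<exists>P. implements P f as out b"
  using assms not_exec_diverge[of b "[]"] unfolding implements_def
  by (intro exI[of _ "[Inc b, Loop b [Inc b]]"]) (simp del: exec_Inc_iff)

lemma implementable_Zero: "implementable Zero"
proof -
  have "rec_eval Zero xs z \<longleftrightarrow> z = 0" for xs z
    by (auto intro: rec_zero elim: rec_zeroE)
  then show ?thesis
    unfolding implementable_def implements_def
    by (intro allI impI exI[of _ "[]"]) (simp add: fun_upd_idem)
qed

text \<open>The common core of projection (\<open>k = 0\<close>) and successor
  (\<open>k = 1\<close>).\<close>

lemma implementable_copy:
  assumes "\<And>xs z. length xs = length as \<Longrightarrow> rec_eval f xs z \<longleftrightarrow> z = xs ! i + k"
    and "frame as out b" "i < length as"
  shows "\<exists>P. implements P f as out b"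
proof -
  let ?P = "Loop (as ! i) [Inc out, Inc b] # Loop b [Inc (as ! i)] # replicate k (Inc out)"
  have inc: "exec (replicate k (Inc out)) \<rho> \<rho>' \<longleftrightarrow> \<rho>' = \<rho>(out := \<rho> out + k)" for \<rho> \<rho>'
    by (induction k arbitrary: \<rho>) simp_all
  from assms(2,3) have "as ! i \<noteq> out" "as ! i \<noteq> b" "out \<noteq> b"
    unfolding frame_def using nth_mem by fastforce+
  then have "implements ?P f as out b"
    unfolding implements_def using assms(1,3)
    by (simp add: exec_copy inc)
  then show ?thesis ..
qed

lemma implementable_Succ: "implementable Succ"
  unfolding implementable_def
proof (intro allI impI)
  fix as out b assume fr: "frame as out b"
  show "\<exists>P. implements P Succ as out b"
  proof (cases "length as = 1")
    case True
    have "rec_eval Succ xs z \<longleftrightarrow> z = xs ! 0 + 1" if "length xs = length as"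
      for xs z
      using that True by (cases xs) (auto elim: rec_succE intro: rec_succ)
    with fr True show ?thesis by (intro implementable_copy) auto
  next
    case False
    then show ?thesis by (intro implements_nowhere_defined) (auto elim: rec_succE)
  qed
qed

lemma implementable_Proj: "implementable (Proj i)"
  unfolding implementable_def
proof (intro allI impI)
  fix as out b assume fr: "frame as out b"
  show "\<exists>P. implements P (Proj i) as out b"
  proof (cases "i < length as")
    case True
    have "rec_eval (Proj i) xs z \<longleftrightarrow> z = xs ! i + 0" if "length xs = length as" for xs z
      using that True by (auto elim: rec_projE intro: rec_proj)
    with fr True show ?thesis by (intro implementable_copy) auto
  next
    case False
    then show ?thesis by (intro implements_nowhere_defined) (auto elim: rec_projE)
  qed
qed

primrec store :: "(nat \<Rightarrow> nat) \<Rightarrow> nat \<Rightarrow> nat list \<Rightarrow> nat \<Rightarrow> nat" where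
  "store \<rho> c [] = \<rho>"
| "store \<rho> c (y # ys) = store (\<rho>(c := y)) (Suc c) ys"

lemma store_apply: "store \<rho> c ys r = (if c \<le> r \<and> r < c + length ys then ys ! (r - c) else \<rho> r)"
  by (induction ys arbitrary: \<rho> c) (auto simp: nth_Cons' Suc_diff_Suc)

definition implements_list :: "nat cmd list \<Rightarrow> recf list \<Rightarrow> nat list \<Rightarrow> nat \<Rightarrow> bool" where
  "implements_list P gs as c \<longleftrightarrow> (\<forall>\<rho> \<rho>'. (\<forall>r\<ge>c. \<rho> r = 0) \<longrightarrow> (exec P \<rho> \<rho>' \<longleftrightarrow>
     (\<exists>ys. list_all2 (\<lambda>g. rec_eval g (map \<rho> as)) gs ys \<and> \<rho>' = store \<rho> c ys)))"

lemma implements_listD: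
  "implements_list P gs as c \<Longrightarrow> \<forall>r\<ge>c. \<rho> r = 0 \<Longrightarrow> exec P \<rho> \<rho>' \<longleftrightarrow>
     (\<exists>ys. list_all2 (\<lambda>g. rec_eval g (map \<rho> as)) gs ys \<and> \<rho>' = store \<rho> c ys)"
  unfolding implements_list_def by blast

text \<open>The results go to the consecutive registers from \<open>c\<close> on, while every
  component uses scratch space from the common bound \<open>e\<close> on; no component disturbs the
  arguments or an earlier result.\<close>

lemma implementable_list:
  assumes "\<And>g. g \<in> set gs \<Longrightarrow> implementable g" "\<forall>a\<in>set as. a < c" "c + length gs \<le> e"
  shows "\<exists>P. implements_list P gs as c"
  using assms
proof (induction gs arbitrary: c)
  case Nil
  show ?case by (auto simp: implements_list_def intro!: exI[of _ "[]"])
next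
  case (Cons g gs)
  from Cons.prems have "frame as c e" unfolding frame_def by fastforce
  moreover from Cons.prems(1) have "implementable g" by simp
  ultimately obtain P where P: "implements P g as c e"
    unfolding implementable_def by blast
  have "\<exists>Q. implements_list Q gs as (Suc c)"
  proof (rule Cons.IH)
    show "implementable g" if "g \<in> set gs" for g using Cons.prems(1) that by simp
    show "\<forall>a\<in>set as. a < Suc c" using Cons.prems(2) by auto
    show "Suc c + length gs \<le> e" using Cons.prems(3) by simp
  qed
  then obtain Q where Q: "implements_list Q gs as (Suc c)" ..
  have "exec (P @ Q) \<rho> \<rho>' \<longleftrightarrow>
      (\<exists>ys. list_all2 (\<lambda>g. rec_eval g (map \<rho> as)) (g # gs) ys \<and> \<rho>' = store \<rho> c ys)"
    if z: "\<forall>r\<ge>c. \<rho> r = 0" for \<rho> \<rho>'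
  proof -
    have as: "map (\<rho>(c := y)) as = map \<rho> as" for y
      using Cons.prems(2) by auto
    have "exec P \<rho> \<rho>1 \<longleftrightarrow> (\<exists>y. rec_eval g (map \<rho> as) y \<and> \<rho>1 = \<rho>(c := y))" for \<rho>1
      using z Cons.prems(3) by (intro implementsD[OF P]) auto
    then have "exec (P @ Q) \<rho> \<rho>' \<longleftrightarrow>
        (\<exists>y. rec_eval g (map \<rho> as) y \<and> exec Q (\<rho>(c := y)) \<rho>')"
      by (auto simp: exec_append)
    also have "\<dots> \<longleftrightarrow> (\<exists>y. rec_eval g (map \<rho> as) y \<and>
        (\<exists>ys. list_all2 (\<lambda>g. rec_eval g (map \<rho> as)) gs ys \<and> \<rho>' = store (\<rho>(c := y)) (Suc c) ys))"
      using z by (simp add: implements_listD[OF Q] as)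
    also have "\<dots> \<longleftrightarrow>
        (\<exists>ys. list_all2 (\<lambda>g. rec_eval g (map \<rho> as)) (g # gs) ys \<and> \<rho>' = store \<rho> c ys)"
      unfolding list_all2_Cons1 by (metis store.simps(2))
    finally show ?thesis .
  qed
  then show ?case unfolding implements_list_def by blast
qed

lemma rec_eval_Comp_iff:
  "rec_eval (Comp f gs) xs z \<longleftrightarrow> (\<exists>ys. list_all2 (\<lambda>g. rec_eval g xs) gs ys \<and> rec_eval f ys z)"
proof
  assume "rec_eval (Comp f gs) xs z"
  then show "\<exists>ys. list_all2 (\<lambda>g. rec_eval g xs) gs ys \<and> rec_eval f ys z"
    by (rule rec_compE) (metis list_all2_conv_all_nth)
next
  assume "\<exists>ys. list_all2 (\<lambda>g. rec_eval g xs) gs ys \<and> rec_eval f ys z"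
  then show "rec_eval (Comp f gs) xs z"
    by (metis list_all2_conv_all_nth rec_comp)
qed

lemma implementable_Comp:
  assumes f: "implementable f" and gs: "\<And>g. g \<in> set gs \<Longrightarrow> implementable g"
  shows "implementable (Comp f gs)"
  unfolding implementable_def
proof (intro allI impI)
  fix as out b assume fr: "frame as out b"
  define e where "e = b + length gs"
  have "\<exists>P. implements_list P gs as b"
    using fr by (intro implementable_list gs) (auto simp: frame_def e_def)
  then obtain P where P: "implements_list P gs as b" ..
  have "frame [b..<e] out e" using fr unfolding frame_def e_def by auto
  with f obtain Q where Q: "implements Q f [b..<e] out e"
    unfolding implementable_def by blast
  \<comment> \<open>The intermediate results lie in \<open>[b..<e]\<close>, which counts as scratch
    space for the whole program and so must be left clean.\<close>
  let ?R = "P @ Q @ map (\<lambda>r. Loop r []) [b..<e]"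
  have "exec ?R \<rho> \<rho>' \<longleftrightarrow> (\<exists>z. rec_eval (Comp f gs) (map \<rho> as) z \<and> \<rho>' = \<rho>(out := z))"
    if out: "\<rho> out = 0" and z: "\<forall>r\<ge>b. \<rho> r = 0" for \<rho> \<rho>'
  proof -
    have main: "exec (Q @ map (\<lambda>r. Loop r []) [b..<e]) (store \<rho> b ys) \<rho>' \<longleftrightarrow>
       (\<exists>z. rec_eval f ys z \<and> \<rho>' = \<rho>(out := z))" if len: "length gs = length ys" for ys
    proof -
      have "map (store \<rho> b ys) [b..<e] = ys"
        using len by (intro nth_equalityI) (auto simp: e_def store_apply)
      moreover have "store \<rho> b ys out = 0" "\<forall>r\<ge>e. store \<rho> b ys r = 0"
        using fr out z len by (auto simp: frame_def e_def store_apply)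
      ultimately have "exec Q (store \<rho> b ys) \<rho>1 \<longleftrightarrow>
          (\<exists>z. rec_eval f ys z \<and> \<rho>1 = (store \<rho> b ys)(out := z))" for \<rho>1
        using implementsD[OF Q] by simp
      moreover have "(\<lambda>r. if r \<in> set [b..<e] then 0 else ((store \<rho> b ys)(out := z)) r) =
          \<rho>(out := z)" for z
        using len fr z by (auto simp: fun_eq_iff e_def store_apply frame_def)
      ultimately show ?thesis by (auto simp: exec_append exec_clear_list)
    qed
    have "exec ?R \<rho> \<rho>' \<longleftrightarrow> (\<exists>ys. list_all2 (\<lambda>g. rec_eval g (map \<rho> as)) gs ys \<and>
        exec (Q @ map (\<lambda>r. Loop r []) [b..<e]) (store \<rho> b ys) \<rho>')"
      by (subst exec_append) (simp add: implements_listD[OF P z], blast)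
    also have "\<dots> \<longleftrightarrow> (\<exists>z. rec_eval (Comp f gs) (map \<rho> as) z \<and> \<rho>' = \<rho>(out := z))"
      unfolding rec_eval_Comp_iff using main list_all2_lengthD by metis
    finally show ?thesis .
  qed
  then show "\<exists>P. implements P (Comp f gs) as out b"
    unfolding implements_def by blast
qed

text \<open>In a minimization the body recomputes the tested register, so the number of rounds
  cannot be read off the register at the start. The induction is on the derivation instead.\<close>

lemma exec_Loop_invariant:
  assumes "exec (Loop r b # K) \<rho> \<rho>'" "I \<rho>"
    and step: "\<And>\<rho> \<rho>1 n. I \<rho> \<Longrightarrow> \<rho> r = Suc n \<Longrightarrow> exec b (\<rho>(r := n)) \<rho>1 \<Longrightarrow> I \<rho>1"
  shows "\<exists>\<rho>1. I \<rho>1 \<and> \<rho>1 r = 0 \<and> exec K \<rho>1 \<rho>'"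
proof -
  \<comment> \<open>\<open>B\<close> is the unfinished part of the current round, and the last
    premise says that completing it establishes the invariant.\<close>
  have "exec L \<rho> \<rho>' \<Longrightarrow> L = B @ Loop r b # K \<Longrightarrow> (\<And>\<rho>1. exec B \<rho> \<rho>1 \<Longrightarrow> I \<rho>1) \<Longrightarrow>
      \<exists>\<rho>1. I \<rho>1 \<and> \<rho>1 r = 0 \<and> exec K \<rho>1 \<rho>'" for L B \<rho>
  proof (induction arbitrary: B rule: exec.induct)
    case (exec_Inc M \<rho> s \<rho>')
    then obtain B' where B: "B = Inc s # B'" "M = B' @ Loop r b # K" by (cases B) auto
    show ?case using exec_Inc.IH[OF B(2)] exec_Inc.prems(2) B(1) by (metis exec_Inc_iff)
  next
    case (exec_Loop_0 \<rho> s M \<rho>' c)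
    show ?case
    proof (cases B)
      case Nil
      with exec_Loop_0 show ?thesis by auto
    next
      case (Cons x B')
      with exec_Loop_0.prems(1) have B: "B = Loop s c # B'" "M = B' @ Loop r b # K" by auto
      show ?thesis
        using exec_Loop_0.IH[OF B(2)] exec_Loop_0.prems(2) exec_Loop_0.hyps(1) B(1)
        by (auto simp: exec_Loop_0_iff)
    qed
  next
    case (exec_Loop_Suc \<rho> s n c M \<rho>')
    show ?case
    proof (cases B)
      case Nil
      with exec_Loop_Suc.prems have "s = r" "c = b" "M = K" "I \<rho>" by auto
      moreover from this have "exec b (\<rho>(r := n)) \<rho>1 \<Longrightarrow> I \<rho>1" for \<rho>1
        using exec_Loop_Suc.hyps(1) step by blast
      ultimately show ?thesis using exec_Loop_Suc.IH[of b] by blast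
    next
      case (Cons x B')
      with exec_Loop_Suc.prems(1)
      have B: "B = Loop s c # B'" "c @ Loop s c # M = (c @ Loop s c # B') @ Loop r b # K" by auto
      show ?thesis
        using exec_Loop_Suc.IH[OF B(2)] exec_Loop_Suc.prems(2)
        unfolding B(1) exec_Loop_Suc_iff[of \<rho> s, OF exec_Loop_Suc.hyps(1)] by blast
    qed
  qed simp
  from this[OF assms(1), of "[]"] assms(2) show ?thesis by auto
qed

lemma rec_eval_PrimRec_0_iff: "rec_eval (PrimRec f g) (0 # xs) z \<longleftrightarrow> rec_eval f xs z"
  by (auto elim: rec_prim_0E intro: rec_prim_0)

lemma rec_eval_PrimRec_Suc_iff:
  "rec_eval (PrimRec f g) (Suc n # xs) z \<longleftrightarrow>
    (\<exists>r. rec_eval (PrimRec f g) (n # xs) r \<and> rec_eval g (n # r # xs) z)"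
  by (auto elim: rec_prim_SucE intro: rec_prim_Suc)

text \<open>The loop for primitive recursion passes through all smaller arguments; this absorbs the
  existential quantifier over the intermediate value.\<close>

lemma rec_eval_PrimRec_below:
  "rec_eval (PrimRec f g) ((m + n) # xs) z \<Longrightarrow> \<exists>r. rec_eval (PrimRec f g) (n # xs) r"
  by (induction m arbitrary: z) (auto simp: rec_eval_PrimRec_Suc_iff)

text \<open>Register \<open>b\<close> counts the completed rounds and is the first argument of
  \<open>g\<close>; \<open>c\<close> holds a copy of the recursion argument and counts the rounds
  left; \<open>out\<close> carries the current value. The next value is computed in
  \<open>t\<close>, since \<open>g\<close> reads \<open>out\<close>, and is then moved.\<close>

lemma implementable_PrimRec:
  assumes f: "implementable f" and g: "implementable g"
  shows "implementable (PrimRec f g)"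
  unfolding implementable_def
proof (intro allI impI)
  fix as out b assume fr: "frame as out b"
  show "\<exists>P. implements P (PrimRec f g) as out b"
  proof (cases as)
    case Nil
    have "\<not> rec_eval (PrimRec f g) [] z" for z
      by (auto elim: rec_eval.cases)
    with Nil show ?thesis by (intro implements_nowhere_defined) auto
  next
    case (Cons a bs)
    define c t e where "c = b + 1" and "t = b + 2" and "e = b + 3"
    note regs = c_def t_def e_def
    from fr Cons have "frame bs out e" "frame (b # out # bs) t e" "a < b" "a \<noteq> out" "out < b"
      unfolding frame_def regs by fastforce+
    then obtain P Q where P: "implements P f bs out e" and Q: "implements Q g (b # out # bs) t e"
      using f g unfolding implementable_def by blast
    note ineqs = \<open>a < b\<close> \<open>a \<noteq> out\<close> \<open>out < b\<close>
    let ?L = "[Loop c (Q @ [Loop out [], Loop t [Inc out], Inc b]), Loop b []]"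
    let ?R = "Loop a [Inc c, Inc t] # Loop t [Inc a] # P @ ?L"
    have "exec ?R \<rho> \<rho>' \<longleftrightarrow> (\<exists>z. rec_eval (PrimRec f g) (map \<rho> as) z \<and> \<rho>' = \<rho>(out := z))"
      if out: "\<rho> out = 0" and z: "\<forall>r\<ge>b. \<rho> r = 0" for \<rho> \<rho>'
    proof -
      define st where "st n m r = \<rho>(b := n, c := m, out := r)" for n m r
      have bs: "map (\<rho>(x := y)) bs = map \<rho> bs" if "x \<ge> b \<or> x = out" for \<rho> :: "nat \<Rightarrow> nat" and x y
        using fr Cons that unfolding frame_def by auto
      have st: "st n m r b = n" "st n m r c = m" "st n m r out = r" "st n m r t = 0"
        "\<forall>s\<ge>e. st n m r s = 0" "map (st n m r) bs = map \<rho> bs" for n m r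
        using ineqs z by (auto simp: st_def regs bs)
      have Q': "exec Q (st n m r) \<rho>1 \<longleftrightarrow>
          (\<exists>y. rec_eval g (n # r # map \<rho> bs) y \<and> \<rho>1 = (st n m r)(t := y))" for n m r \<rho>1
        using implementsD[OF Q, of "st n m r" \<rho>1] by (simp add: st)
      have body: "exec (Q @ [Loop out [], Loop t [Inc out], Inc b] @ ?L) (st n m r) \<rho>' \<longleftrightarrow>
          (\<exists>y. rec_eval g (n # r # map \<rho> bs) y \<and> exec ?L (st (Suc n) m y) \<rho>')" for n m r
      proof -
        have "exec (Loop out [] # Loop t [Inc out] # Inc b # ?L) ((st n m r)(t := y)) \<rho>' \<longleftrightarrow>
            exec ?L (st (Suc n) m y) \<rho>'" for y
        proof -
          let ?s1 = "(st n m r)(t := y, out := 0)"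
          let ?s2 = "?s1(t := 0, out := ?s1 out + ?s1 t)"
          have t_out: "t \<noteq> out" using ineqs by (simp add: regs)
          have "exec (Loop out [] # Loop t [Inc out] # Inc b # ?L) ((st n m r)(t := y)) \<rho>' \<longleftrightarrow>
              exec ?L (?s2(b := Suc (?s2 b))) \<rho>'"
            by (simp only: exec_clear exec_move[OF t_out] exec_Inc_iff)
          also have "?s2(b := Suc (?s2 b)) = st (Suc n) m y"
            using ineqs z by (auto simp: st_def regs fun_eq_iff)
          finally show ?thesis .
        qed
        then show ?thesis
          by (subst exec_append) (auto simp: Q')
      qed
      \<comment> \<open>With the value at \<open>n\<close> stored and \<open>m\<close> rounds left,
        the loop delivers the value at \<open>m + n\<close>.\<close>
      have loop: "exec ?L (st n m r) \<rho>' \<longleftrightarrow>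
          (\<exists>y. rec_eval (PrimRec f g) ((m + n) # map \<rho> bs) y \<and> \<rho>' = \<rho>(out := y))"
        if "rec_eval (PrimRec f g) (n # map \<rho> bs) r" for n m r
        using that
      proof (induction m arbitrary: n r)
        case 0
        have "exec ?L (st n 0 r) \<rho>' \<longleftrightarrow> \<rho>' = (st n 0 r)(b := 0)"
          by (simp add: exec_Loop_0_iff st exec_clear)
        also have "(st n 0 r)(b := 0) = \<rho>(out := r)"
          using z ineqs by (auto simp: st_def regs fun_eq_iff)
        finally show ?case
          using 0 rec_eval_deterministic by (simp only: add_0) blast
      next
        case (Suc m)
        have step: "rec_eval (PrimRec f g) (Suc n # map \<rho> bs) y \<longleftrightarrow>
            rec_eval g (n # r # map \<rho> bs) y" for y
          using Suc.prems rec_eval_deterministic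
          by (metis rec_eval_PrimRec_Suc_iff)
        have "(st n (Suc m) r)(c := m) = st n m r"
          using ineqs by (auto simp: st_def regs fun_eq_iff)
        then have "exec ?L (st n (Suc m) r) \<rho>' \<longleftrightarrow>
            (\<exists>y. rec_eval g (n # r # map \<rho> bs) y \<and> exec ?L (st (Suc n) m y) \<rho>')"
          using body[of n m r] by (simp add: exec_Loop_Suc_iff[of _ c m] st)
        also have "\<dots> \<longleftrightarrow> (\<exists>y. rec_eval (PrimRec f g) (Suc n # map \<rho> bs) y \<and>
            (\<exists>y. rec_eval (PrimRec f g) ((m + Suc n) # map \<rho> bs) y \<and> \<rho>' = \<rho>(out := y)))"
          using Suc.IH step by blast
        also have "\<dots> \<longleftrightarrow>
            (\<exists>y. rec_eval (PrimRec f g) ((m + Suc n) # map \<rho> bs) y \<and> \<rho>' = \<rho>(out := y))"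
          using rec_eval_PrimRec_below by blast
        finally show ?case by (simp only: add_Suc add_Suc_right)
      qed
      have "exec ?R \<rho> \<rho>' \<longleftrightarrow> exec (P @ ?L) (\<rho>(c := \<rho> a)) \<rho>'"
        using ineqs z by (subst exec_copy) (auto simp: regs)
      also have "\<dots> \<longleftrightarrow> (\<exists>y. rec_eval f (map \<rho> bs) y \<and> exec ?L (st 0 (\<rho> a) y) \<rho>')"
      proof -
        have "\<rho>(c := \<rho> a, out := y) = st 0 (\<rho> a) y" for y
          using z by (auto simp: st_def fun_eq_iff)
        moreover have "exec P (\<rho>(c := \<rho> a)) \<rho>1 \<longleftrightarrow>
            (\<exists>y. rec_eval f (map \<rho> bs) y \<and> \<rho>1 = \<rho>(c := \<rho> a, out := y))" for \<rho>1
        proof -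
          have "map (\<rho>(c := \<rho> a)) bs = map \<rho> bs" by (simp add: bs regs del: map_eq_conv)
          moreover have "(\<rho>(c := \<rho> a)) out = 0" "\<forall>r\<ge>e. (\<rho>(c := \<rho> a)) r = 0"
            using z out ineqs by (auto simp: regs)
          ultimately show ?thesis using implementsD[OF P] by presburger
        qed
        ultimately show ?thesis by (subst exec_append) auto
      qed
      also have "\<dots> \<longleftrightarrow> (\<exists>y. rec_eval f (map \<rho> bs) y \<and>
          (\<exists>y. rec_eval (PrimRec f g) (\<rho> a # map \<rho> bs) y \<and> \<rho>' = \<rho>(out := y)))"
        using loop[of 0] by (auto simp: rec_eval_PrimRec_0_iff)
      also have "\<dots> \<longleftrightarrow> (\<exists>y. rec_eval (PrimRec f g) (\<rho> a # map \<rho> bs) y \<and> \<rho>' = \<rho>(out := y))"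
        using rec_eval_PrimRec_below[of f g _ 0] by (auto simp: rec_eval_PrimRec_0_iff)
      finally show ?thesis by (simp add: Cons)
    qed
    then show ?thesis unfolding implements_def by blast
  qed
qed

text \<open>Register \<open>b\<close> holds the candidate and \<open>t\<close> the value of
  \<open>f\<close> at it. Entering a round has only decremented \<open>t\<close>, so the body clears
  the rest before trying the next candidate. The final loop moves the candidate to
  \<open>out\<close>, which also cleans \<open>b\<close>.\<close>

lemma implementable_Mu:
  assumes f: "implementable f"
  shows "implementable (Mu f)"
  unfolding implementable_def
proof (intro allI impI)
  fix as out b assume fr: "frame as out b"
  define t e where "t = b + 1" and "e = b + 2"
  note regs = t_def e_def
  from fr have "frame (b # as) t e" and ineq: "out < b"
    unfolding frame_def regs by fastforce+
  with f obtain P where P: "implements P f (b # as) t e"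
    unfolding implementable_def by blast
  let ?body = "Loop t [] # Inc b # P"
  let ?L = "[Loop t ?body, Loop b [Inc out]]"
  have "exec (P @ ?L) \<rho> \<rho>' \<longleftrightarrow> (\<exists>z. rec_eval (Mu f) (map \<rho> as) z \<and> \<rho>' = \<rho>(out := z))"
    if out: "\<rho> out = 0" and z: "\<forall>r\<ge>b. \<rho> r = 0" for \<rho> \<rho>'
  proof -
    define st where "st n k = \<rho>(b := n, t := k)" for n k
    let ?f = "\<lambda>n. rec_eval f (n # map \<rho> as)"
    have as: "map (\<rho>(x := y)) as = map \<rho> as" if "x \<ge> b" for \<rho> :: "nat \<Rightarrow> nat" and x y
      using fr that unfolding frame_def by auto
    have st: "st n k b = n" "st n k out = 0" "st n k t = k"
      "\<forall>s\<ge>e. st n k s = 0" "map (st n k) as = map \<rho> as" for n k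
      using ineq out z by (auto simp: st_def regs as)
    have start: "st 0 0 = \<rho>" using z by (auto simp: st_def regs fun_eq_iff)
    have upd: "(st n k)(t := l) = st n l" "(st n k)(b := m) = st m k" for n k l m
      by (auto simp: st_def regs fun_eq_iff)
    have P': "exec P (st n 0) \<rho>1 \<longleftrightarrow> (\<exists>k. ?f n k \<and> \<rho>1 = st n k)" for n \<rho>1
      using implementsD[OF P, of "st n 0" \<rho>1] by (simp add: st upd)
    have final: "exec [Loop b [Inc out]] (st n 0) \<rho>' \<longleftrightarrow> \<rho>' = \<rho>(out := n)" for n
    proof -
      have "(st n 0)(b := 0, out := n) = \<rho>(out := n)"
        using z by (auto simp: st_def regs fun_eq_iff)
      then show ?thesis using ineq by (simp add: exec_move st)
    qed
    show ?thesis
    proof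
      assume "exec (P @ ?L) \<rho> \<rho>'"
      then obtain k where k: "?f 0 k" "exec ?L (st 0 k) \<rho>'"
        using P'[of 0] by (auto simp: exec_append start)
      let ?I = "\<lambda>\<rho>. \<exists>n k. \<rho> = st n k \<and> ?f n k \<and> (\<forall>i<n. \<exists>k. ?f i (Suc k))"
      have "\<exists>\<rho>1. ?I \<rho>1 \<and> \<rho>1 t = 0 \<and> exec [Loop b [Inc out]] \<rho>1 \<rho>'"
      proof (rule exec_Loop_invariant[OF k(2)])
        show "?I (st 0 k)" using k(1) by blast
      next
        fix \<sigma> \<rho>1 m
        assume "?I \<sigma>" "\<sigma> t = Suc m" "exec ?body (\<sigma>(t := m)) \<rho>1"
        then obtain n where n: "?f n (Suc m)" "\<forall>i<n. \<exists>k. ?f i (Suc k)" "exec ?body (st n m) \<rho>1"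
          by (auto simp: st upd)
        from n(3) obtain k where "?f (Suc n) k" "\<rho>1 = st (Suc n) k"
          by (auto simp: exec_clear upd st P')
        with n(1,2) show "?I \<rho>1"
          by (intro exI[of _ "Suc n"] exI[of _ k]) (auto simp: less_Suc_eq)
      qed
      then obtain n where "?f n 0" "\<forall>i<n. \<exists>k. ?f i (Suc k)" "exec [Loop b [Inc out]] (st n 0) \<rho>'"
        by (auto simp: st)
      then show "\<exists>z. rec_eval (Mu f) (map \<rho> as) z \<and> \<rho>' = \<rho>(out := z)"
        by (auto simp: final intro: rec_mu)
    next
      assume "\<exists>z. rec_eval (Mu f) (map \<rho> as) z \<and> \<rho>' = \<rho>(out := z)"
      then obtain n where n: "?f n 0" "\<forall>i<n. \<exists>k. ?f i (Suc k)" "\<rho>' = \<rho>(out := n)"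
        by (auto elim: rec_muE)
      \<comment> \<open>Downward induction from the minimum \<open>n\<close>: the run from candidate
        \<open>m\<close> is one round followed by the run from \<open>Suc m\<close>.\<close>
      have "exec (P @ ?L) (st m 0) \<rho>'" if "m \<le> n" for m
        using that
      proof (induction rule: inc_induct)
        case base
        have "exec P (st n 0) (st n 0)" using P' n(1) by blast
        moreover have "exec ?L (st n 0) \<rho>'"
          using final n(3) by (simp add: exec_Loop_0_iff st)
        ultimately show ?case by (auto simp only: exec_append)
      next
        case (step m)
        with n(2) obtain k where "exec P (st m 0) (st m (Suc k))" using P' by blast
        moreover have "exec ?L (st m (Suc k)) \<rho>'"
          using step.IH by (simp add: exec_Loop_Suc_iff[of _ t k] st upd exec_clear)
        ultimately show ?case by (auto simp only: exec_append)
      qed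
      from this[of 0] show "exec (P @ ?L) \<rho> \<rho>'" by (simp add: start)
    qed
  qed
  then show "\<exists>P. implements P (Mu f) as out b" unfolding implements_def by blast
qed

lemma implementable: "implementable f"
  by (induction f)
    (simp_all add: implementable_Zero implementable_Succ implementable_Proj implementable_Comp
      implementable_PrimRec implementable_Mu)

lemma halting_program:
  "\<exists>P :: nat cmd list. \<forall>n. (\<exists>\<rho>'. exec P ((\<lambda>_. 0)(0 := n)) \<rho>') \<longleftrightarrow> (\<exists>z. rec_eval f [n] z)"
proof -
  have "frame [0] 1 2" by (simp add: frame_def)
  with implementable[of f] obtain P where P: "implements P f [0] 1 2"
    unfolding implementable_def by blast
  have "(\<exists>\<rho>'. exec P ((\<lambda>_. 0)(0 := n)) \<rho>') \<longleftrightarrow> (\<exists>z. rec_eval f [n] z)" for n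
    using implementsD[OF P, of "(\<lambda>_. 0)(0 := n)"] by simp
  then show ?thesis by blast
qed

section \<open>Programs as systems of linear rules\<close>

definition nth_prime :: "nat \<Rightarrow> nat" where
  "nth_prime = Infinite_Set.enumerate {p. prime p}"

lemma prime_nth_prime [simp]: "prime (nth_prime r)"
  using enumerate_in_set[OF primes_infinite] unfolding nth_prime_def by auto

lemma nth_prime_less_iff: "nth_prime r < nth_prime s \<longleftrightarrow> r < s"
  unfolding nth_prime_def by (rule enumerate_mono_iff[OF primes_infinite])

lemma nth_prime_eq_iff [simp]: "nth_prime r = nth_prime s \<longleftrightarrow> r = s"
  by (metis nth_prime_less_iff linorder_neq_iff)

lemma nth_prime_pos [simp]: "0 < nth_prime r"
  by (rule prime_gt_0_nat) simp

lemma nth_prime_0: "nth_prime 0 = 2"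
  unfolding nth_prime_def enumerate_0 by (intro Least_equality) (auto intro: prime_ge_2_nat)

lemma multiplicity_nth_prime_mult:
  assumes "0 < N"
  shows "multiplicity (nth_prime r) (nth_prime s * N) =
    (if r = s then Suc (multiplicity (nth_prime r) N) else multiplicity (nth_prime r) N)"
proof -
  have "multiplicity (nth_prime r) (nth_prime s * N) =
      multiplicity (nth_prime r) (nth_prime s) + multiplicity (nth_prime r) N"
    using assms nth_prime_pos[of s] by (intro prime_elem_multiplicity_mult_distrib) auto
  moreover have "multiplicity (nth_prime r) (nth_prime s) = (if r = s then 1 else 0)"
    by (auto simp: prime_multiplicity_other intro: multiplicity_prime)
  ultimately show ?thesis by simp
qed

text \<open>Only exponents of primes with index below \<open>B\<close> are prescribed. The prime
  with index \<open>B\<close> stays free and can be multiplied in at each step without changing the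
  registers.\<close>

definition encodes :: "nat \<Rightarrow> nat \<Rightarrow> (nat \<Rightarrow> nat) \<Rightarrow> bool" where
  "encodes B N \<rho> \<longleftrightarrow> 0 < N \<and> (\<forall>r<B. multiplicity (nth_prime r) N = \<rho> r)"

lemma encodes_clock: "encodes B N \<rho> \<Longrightarrow> encodes B (nth_prime B * N) \<rho>"
  by (auto simp: encodes_def multiplicity_nth_prime_mult)

lemma encodes_Suc:
  "encodes B N \<rho> \<Longrightarrow> r < B \<Longrightarrow> encodes B (nth_prime r * N) (\<rho>(r := Suc (\<rho> r)))"
  by (auto simp: encodes_def multiplicity_nth_prime_mult)

lemma encodes_pred: "encodes B (nth_prime r * N) \<rho> \<Longrightarrow> encodes B N (\<rho>(r := \<rho> r - 1))"
  by (auto simp: encodes_def multiplicity_nth_prime_mult split: if_splits)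

lemma encodes_dvd_iff: "encodes B N \<rho> \<Longrightarrow> r < B \<Longrightarrow> nth_prime r dvd N \<longleftrightarrow> 0 < \<rho> r"
  unfolding encodes_def by (metis prime_multiplicity_gt_zero_iff prime_imp_prime_elem
      prime_nth_prime less_not_refl)

text \<open>Register 0 is the input register and belongs to the prime 2; the starting number is
  therefore exactly the length of the value of \<open>zeros n\<close>.\<close>

lemma encodes_init: "encodes B (2 ^ n) ((\<lambda>_. 0)(0 := n))"
proof (induction n)
  case 0
  show ?case by (simp add: encodes_def)
next
  case (Suc n)
  then show ?case
    by (auto simp: encodes_def nth_prime_0[symmetric] multiplicity_nth_prime_mult)
qed

text \<open>
  Every step also multiplies by the prime \<open>c\<close>. If \<open>c\<close> exceeds all primes in use, the number
  grows strictly along every run.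
\<close>

fun succ_conf :: "nat \<Rightarrow> nat cmd list \<times> nat \<Rightarrow> nat cmd list \<times> nat" where
  "succ_conf c ([], N) = ([], N)"
| "succ_conf c (Inc r # K, N) = (K, c * (nth_prime r * N))"
| "succ_conf c (Loop r b # K, N) =
    (if nth_prime r dvd N then (b @ Loop r b # K, c * (N div nth_prime r)) else (K, c * N))"

definition mstep :: "nat \<Rightarrow> nat cmd list \<times> nat \<Rightarrow> nat cmd list \<times> nat \<Rightarrow> bool" where
  "mstep c x y \<longleftrightarrow> fst x \<noteq> [] \<and> y = succ_conf c x"

definition regs :: "'r cmd list \<Rightarrow> 'r set" where
  "regs K = (\<Union>x\<in>set K. set_cmd x)"

lemma regs_simps [simp]:
  "regs [] = {}"
  "regs (Inc r # K) = insert r (regs K)"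
  "regs (Loop r b # K) = insert r (regs b \<union> regs K)"
  "regs (K @ L) = regs K \<union> regs L"
  by (auto simp: regs_def)

lemma finite_set_cmd: "finite (set_cmd x)"
  by (induction x) auto

lemma finite_regs: "finite (regs K)"
  by (auto simp: regs_def finite_set_cmd)

lemma exec_imp_mstep:
  assumes "exec K \<rho> \<rho>'" "regs K \<subseteq> {..<B}" "encodes B N \<rho>"
  shows "\<exists>N'. (mstep (nth_prime B))\<^sup>*\<^sup>* (K, N) ([], N')"
  using assms
proof (induction arbitrary: N rule: exec.induct)
  case (exec_Nil \<rho>)
  show ?case by blast
next
  case (exec_Inc K \<rho> r \<rho>')
  let ?N = "nth_prime B * (nth_prime r * N)"
  have "encodes B ?N (\<rho>(r := Suc (\<rho> r)))"
    using exec_Inc.prems by (intro encodes_clock encodes_Suc) auto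
  moreover have "mstep (nth_prime B) (Inc r # K, N) (K, ?N)"
    by (simp add: mstep_def)
  ultimately show ?case
    using exec_Inc.IH exec_Inc.prems(1)
    by (metis converse_rtranclp_into_rtranclp insert_subset regs_simps(2))
next
  case (exec_Loop_0 \<rho> r K \<rho>' b)
  then have "mstep (nth_prime B) (Loop r b # K, N) (K, nth_prime B * N)"
    by (auto simp: mstep_def encodes_dvd_iff)
  moreover have "encodes B (nth_prime B * N) \<rho>"
    using exec_Loop_0.prems by (intro encodes_clock)
  ultimately show ?case
    using exec_Loop_0.IH exec_Loop_0.prems(1)
    by (metis converse_rtranclp_into_rtranclp insert_subset le_sup_iff regs_simps(3))
next
  case (exec_Loop_Suc \<rho> r n b K \<rho>')
  then have "nth_prime r dvd N" by (auto simp: encodes_dvd_iff)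
  then obtain m where m: "N = nth_prime r * m" ..
  have "mstep (nth_prime B) (Loop r b # K, N) (b @ Loop r b # K, nth_prime B * m)"
    using m by (auto simp: mstep_def)
  moreover have "encodes B (nth_prime B * m) (\<rho>(r := n))"
    using encodes_clock[OF encodes_pred[of B r m \<rho>]] exec_Loop_Suc.prems(2) exec_Loop_Suc.hyps(1) m
    by simp
  ultimately show ?case
    using exec_Loop_Suc.IH exec_Loop_Suc.prems(1)
    by (metis converse_rtranclp_into_rtranclp insert_subset le_sup_iff regs_simps(3,4))
qed

lemma mstep_imp_exec:
  assumes "(mstep (nth_prime B))\<^sup>*\<^sup>* (K, N) ([], N')" "regs K \<subseteq> {..<B}" "encodes B N \<rho>"
  shows "\<exists>\<rho>'. exec K \<rho> \<rho>'"
  using assms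
proof (induction "(K, N)" arbitrary: K N \<rho> rule: converse_rtranclp_induct)
  case base
  show ?case by (blast intro: exec_Nil)
next
  case (step y)
  obtain L M where y: "y = (L, M)" by fastforce
  note IH = step.hyps(3)[OF y]
  show ?case
  proof (cases K rule: list.exhaust)
    case Nil
    with step.hyps(1) show ?thesis by (simp add: mstep_def)
  next
    case (Cons x K')
    show ?thesis
    proof (cases x)
      case (Inc r)
      with Cons y step.hyps(1) have "L = K'" "M = nth_prime B * (nth_prime r * N)"
        by (auto simp: mstep_def)
      moreover from this Inc Cons step.prems have "encodes B M (\<rho>(r := Suc (\<rho> r)))"
        by (auto intro!: encodes_clock encodes_Suc)
      ultimately show ?thesis using IH[of "\<rho>(r := Suc (\<rho> r))"] step.prems(1) Inc Cons by auto
    next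
      case (Loop r b)
      show ?thesis
      proof (cases "\<rho> r")
        case 0
        with Loop Cons y step.hyps(1) step.prems have "L = K'" "M = nth_prime B * N"
          by (auto simp: mstep_def encodes_dvd_iff)
        moreover from this step.prems have "encodes B M \<rho>"
          by (auto intro!: encodes_clock)
        ultimately show ?thesis
          using IH[of \<rho>] step.prems(1) Loop Cons 0 by (auto simp: exec_Loop_0_iff)
      next
        case (Suc n)
        with step.prems Loop Cons have "nth_prime r dvd N" by (auto simp: encodes_dvd_iff)
        then obtain m where m: "N = nth_prime r * m" ..
        with Loop Cons y step.hyps(1) have LM: "L = b @ Loop r b # K'" "M = nth_prime B * m"
          by (auto simp: mstep_def)
        have "encodes B M (\<rho>(r := n))"
          using encodes_clock[OF encodes_pred[of B r m \<rho>]] step.prems(2) m Suc LM(2) by simp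
        then show ?thesis
          using IH[of "\<rho>(r := n)"] step.prems(1) Loop Cons Suc LM(1)
          by (auto simp: exec_Loop_Suc_iff[of \<rho> r n])
      qed
    qed
  qed
qed

lemma succ_conf_grows:
  assumes "0 < N" "K \<noteq> []" "regs K \<subseteq> {..<B}"
  shows "N < snd (succ_conf (nth_prime B) (K, N))"
proof -
  have B: "1 < nth_prime B" using prime_nth_prime prime_gt_1_nat by blast
  obtain x K' where K: "K = x # K'" using assms(2) by (cases K) auto
  show ?thesis
  proof (cases x)
    case (Inc r)
    have "N \<le> nth_prime r * N" by (simp add: Suc_leI)
    also have "\<dots> < nth_prime B * (nth_prime r * N)" using B assms(1) by simp
    finally show ?thesis using K Inc by simp
  next
    case (Loop r b)
    show ?thesis
    proof (cases "nth_prime r dvd N")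
      case True
      then obtain m where m: "N = nth_prime r * m" ..
      have "nth_prime r < nth_prime B" using K Loop assms(3) by (simp add: nth_prime_less_iff)
      then show ?thesis using K Loop m assms(1) by simp
    next
      case False
      then show ?thesis using K Loop B assms(1) by simp
    qed
  qed
qed

section \<open>Finiteness of the set of control states\<close>

fun succ_progs :: "'r cmd list \<Rightarrow> 'r cmd list set" where
  "succ_progs [] = {}"
| "succ_progs (Inc r # K) = {K}"
| "succ_progs (Loop r b # K) = {b @ Loop r b # K, K}"

text \<open>Closure is relative to the continuation \<open>K\<close>, through which control leaves
  \<open>S\<close>. Sets for consecutive commands can then be joined: the exit of one is the entry
  of the next.\<close>

lemma finite_closure_append:
  assumes "\<And>x K. x \<in> set L \<Longrightarrow>
      \<exists>S. finite S \<and> x # K \<in> S \<and> (\<forall>M\<in>S. succ_progs M \<subseteq> insert K S)"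
  shows "\<exists>S. finite S \<and> L @ K \<in> insert K S \<and> (\<forall>M\<in>S. succ_progs M \<subseteq> insert K S)"
  using assms
proof (induction L)
  case Nil
  show ?case by (intro exI[of _ "{}"]) simp
next
  case (Cons x L)
  then obtain S where S: "finite S" "L @ K \<in> insert K S" "\<forall>M\<in>S. succ_progs M \<subseteq> insert K S"
    by (metis list.set_intros(2))
  obtain T where "finite T" "x # L @ K \<in> T" "\<forall>M\<in>T. succ_progs M \<subseteq> insert (L @ K) T"
    using Cons.prems[of x "L @ K"] by (metis list.set_intros(1))
  with S show ?case by (intro exI[of _ "S \<union> T"]) auto
qed

text \<open>The continuation of a loop body is the loop itself, so the states met inside the body
  return to it, and one more state suffices.\<close>

lemma finite_closure_cmd:
  "\<exists>S. finite S \<and> x # K \<in> S \<and> (\<forall>M\<in>S. succ_progs M \<subseteq> insert K S)"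
proof (induction x arbitrary: K)
  case (Inc r)
  show ?case by (intro exI[of _ "{Inc r # K}"]) simp
next
  case (Loop r b)
  obtain S where S: "finite S" "b @ Loop r b # K \<in> insert (Loop r b # K) S"
    "\<forall>M\<in>S. succ_progs M \<subseteq> insert (Loop r b # K) S"
    using finite_closure_append[of b "Loop r b # K"] Loop by blast
  then show ?case by (intro exI[of _ "insert (Loop r b # K) S"]) auto
qed

lemma finite_closure:
  "\<exists>S. finite S \<and> P \<in> S \<and> (\<forall>M\<in>S. succ_progs M \<subseteq> S)"
proof -
  obtain S where "finite S" "P \<in> insert [] S" "\<forall>M\<in>S. succ_progs M \<subseteq> insert [] S"
    using finite_closure_append[of P "[]"] finite_closure_cmd by (metis append_Nil2)
  then show ?thesis by (intro exI[of _ "insert [] S"]) auto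
qed

lemma succ_conf_in_succ_progs: "K \<noteq> [] \<Longrightarrow> fst (succ_conf c (K, N)) \<in> succ_progs K"
  by (cases "(c, K, N)" rule: succ_conf.cases) auto

lemma regs_succ_progs: "M \<in> succ_progs K \<Longrightarrow> regs M \<subseteq> regs K"
  by (cases K rule: succ_progs.cases) auto

section \<open>Finite systems of linear rules\<close>

type_synonym rule = "(nat \<times> nat \<times> nat) \<times> (nat \<times> nat \<times> nat)"

inductive rstep :: "rule set \<Rightarrow> nat \<times> nat \<Rightarrow> nat \<times> nat \<Rightarrow> bool" for R where
  "((q, k, j), (q', k', j')) \<in> R \<Longrightarrow> rstep R (q, k * m + j) (q', k' * m + j')"

text \<open>A test for zero becomes a case distinction modulo the prime p of \<open>r\<close>.
  Residue 0 means that the register is positive and is decremented; each other residue j has its own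
  rule, taking p m + j to c p m + c j, that is, to c times the number.\<close>

fun rules :: "nat \<Rightarrow> (nat cmd list \<Rightarrow> nat) \<Rightarrow> nat cmd list \<Rightarrow> rule set" where
  "rules c e [] = {}"
| "rules c e (Inc r # K) = {((e (Inc r # K), 1, 0), (e K, c * nth_prime r, 0))}"
| "rules c e (Loop r b # K) =
    insert ((e (Loop r b # K), nth_prime r, 0), (e (b @ Loop r b # K), c, 0))
     ((\<lambda>j. ((e (Loop r b # K), nth_prime r, j), (e K, c * nth_prime r, c * j))) ` {0<..<nth_prime r})"

lemma finite_rules: "finite (rules c e K)"
  by (cases K rule: succ_progs.cases) auto

lemma rules_state: "((q, x), y) \<in> rules c e K \<Longrightarrow> q = e K"
  by (cases K rule: succ_progs.cases) auto

lemma rules_coeff_pos: "((q, k, j), y) \<in> rules c e K \<Longrightarrow> 0 < k"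
  by (cases K rule: succ_progs.cases) auto

lemma rstep_iff:
  "rstep R (q, N) y \<longleftrightarrow>
    (\<exists>k j q' k' j' m. ((q, k, j), (q', k', j')) \<in> R \<and> N = k * m + j \<and> y = (q', k' * m + j'))"
  unfolding rstep.simps prod.inject by blast

lemma rstep_insert_iff:
  "rstep (insert ((q, k, j), (q', k', j')) R) (r, N) y \<longleftrightarrow>
    r = q \<and> (\<exists>m. N = k * m + j \<and> y = (q', k' * m + j')) \<or> rstep R (r, N) y"
  unfolding rstep_iff by blast

lemma rstep_image_iff:
  "rstep ((\<lambda>j. ((q, k, j), (q', k', f j))) ` J) (r, N) y \<longleftrightarrow>
    r = q \<and> (\<exists>j\<in>J. \<exists>m. N = k * m + j \<and> y = (q', k' * m + f j))"
  unfolding rstep_iff by blast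

lemma not_rstep_empty: "\<not> rstep {} x y"
  by (cases x) (simp add: rstep_iff)

lemma rstep_rules_iff:
  "rstep (rules c e K) (e K, N) y \<longleftrightarrow> K \<noteq> [] \<and> y = map_prod e id (succ_conf c (K, N))"
proof (cases K rule: succ_progs.cases)
  case 1
  then show ?thesis by (simp add: not_rstep_empty)
next
  case (2 r L)
  then show ?thesis by (simp add: not_rstep_empty rstep_insert_iff mult.assoc)
next
  case (3 r b L)
  let ?p = "nth_prime r"
  have "rstep (rules c e K) (e K, N) y \<longleftrightarrow> (\<exists>m. N = ?p * m \<and> y = (e (b @ K), c * m)) \<or>
      (\<exists>j\<in>{0<..<?p}. \<exists>m. N = ?p * m + j \<and> y = (e L, c * ?p * m + c * j))"
    using 3 by (simp only: rules.simps rstep_insert_iff rstep_image_iff) simp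
  also have "\<dots> \<longleftrightarrow> (\<exists>m. N = ?p * m \<and> y = (e (b @ K), c * m)) \<or>
      (\<exists>j\<in>{0<..<?p}. \<exists>m. N = ?p * m + j) \<and> y = (e L, c * N)"
    unfolding mult.assoc distrib_left[symmetric] by blast
  also have "\<dots> \<longleftrightarrow> y = map_prod e id (succ_conf c (K, N))"
  proof (cases "?p dvd N")
    case True
    then obtain m where m: "N = ?p * m" ..
    have "\<not> ?p dvd j" if "j \<in> {0<..<?p}" for j
      using that by (auto dest: nat_dvd_not_less)
    then have "\<not> (\<exists>j\<in>{0<..<?p}. \<exists>m. N = ?p * m + j)"
      using True by (metis dvd_add_right_iff dvd_triv_left)
    moreover have "N = ?p * n \<longleftrightarrow> n = m" for n
      using m nth_prime_pos[of r] by (metis mult_left_cancel less_not_refl)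
    moreover have "map_prod e id (succ_conf c (K, N)) = (e (b @ K), c * m)"
      using True 3 m by simp
    ultimately show ?thesis by auto
  next
    case False
    have "N = ?p * (N div ?p) + N mod ?p" "N mod ?p \<in> {0<..<?p}"
      using False by (auto simp: dvd_eq_mod_eq_0)
    then have "\<exists>j\<in>{0<..<?p}. \<exists>m. N = ?p * m + j" by blast
    moreover have "\<not> (\<exists>m. N = ?p * m \<and> y = (e (b @ K), c * m))"
      using False by (blast intro: dvdI)
    moreover have "map_prod e id (succ_conf c (K, N)) = (e L, c * N)"
      using False 3 by simp
    ultimately show ?thesis by metis
  qed
  finally show ?thesis using 3 by blast
qed

text \<open>What the word constructions require of a machine. Determinism and finality of
  \<open>h\<close> make a halting run closed under the rules; growth and progress give the converse
  in the substring structure; positive coefficients keep the block length m below the number k m +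
  j. Progress is claimed for configurations reachable from a start only.\<close>

locale growing_system =
  fixes R :: "rule set" and h :: nat
  assumes finite_R: "finite R"
    and coeff_pos: "((q, k, j), p) \<in> R \<Longrightarrow> 0 < k"
    and deterministic: "rstep R x y \<Longrightarrow> rstep R x z \<Longrightarrow> y = z"
    and grows: "rstep R (q, N) (q', N') \<Longrightarrow> 0 < N \<Longrightarrow> N < N'"
    and halted: "\<not> rstep R (h, N) y"
    and progress: "(rstep R)\<^sup>*\<^sup>* (0, 2 ^ n) (q, N) \<Longrightarrow> q \<noteq> h \<Longrightarrow> \<exists>y. rstep R (q, N) y"
begin

definition halts :: "nat \<Rightarrow> bool" where
  "halts n \<longleftrightarrow> (\<exists>N. (rstep R)\<^sup>*\<^sup>* (0, 2 ^ n) (h, N))"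

end

lemma halting_system: "\<exists>R h. growing_system R h \<and>
    (\<forall>n. growing_system.halts R h n \<longleftrightarrow> (\<exists>z. rec_eval f [n] z))"
proof -
  obtain P :: "nat cmd list" where
    P: "\<forall>n. (\<exists>\<rho>'. exec P ((\<lambda>_. 0)(0 := n)) \<rho>') \<longleftrightarrow> (\<exists>z. rec_eval f [n] z)"
    using halting_program ..
  obtain B where B: "regs P \<subseteq> {..<B}"
    using finite_regs finite_nat_iff_bounded by blast
  obtain S0 where S0: "finite S0" "P \<in> S0" "\<forall>K\<in>S0. succ_progs K \<subseteq> S0"
    using finite_closure by blast
  \<comment> \<open>The empty program is added explicitly: with \<open>e\<close> injective on a set
    containing it, the halting state differs from the state of every nonempty program in
    \<open>S\<close>.\<close>
  define S where "S = insert [] {K \<in> S0. regs K \<subseteq> {..<B}}"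
  have S: "finite S" "[] \<in> S" "P \<in> S" "\<And>K. K \<in> S \<Longrightarrow> regs K \<subseteq> {..<B}"
    using S0(1,2) B by (auto simp: S_def)
  have S_closed: "succ_progs K \<subseteq> S" if "K \<in> S" for K
  proof
    fix M assume M: "M \<in> succ_progs K"
    with that have "K \<in> S0" by (auto simp: S_def)
    with M S0(3) have "M \<in> S0" by blast
    with M show "M \<in> S" using regs_succ_progs[OF M] S(4)[OF that] by (auto simp: S_def)
  qed
  obtain e0 :: "nat cmd list \<Rightarrow> nat" where e0: "inj_on e0 S"
    using finite_imp_inj_to_nat_seg[OF S(1)] by blast
  \<comment> \<open>Runs start in state 0, so \<open>P\<close> gets this number and all other
    programs are shifted by one.\<close>
  define e where "e K = (if K = P then 0 else Suc (e0 K))" for K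
  have inj: "inj_on e S" using e0 by (auto simp: e_def inj_on_def)
  define c where "c = nth_prime B"
  define R where "R = (\<Union>K\<in>S. rules c e K)"
  define h where "h = e []"
  have rstep_R: "rstep R (q, N) y \<longleftrightarrow>
      (\<exists>K\<in>S. K \<noteq> [] \<and> q = e K \<and> y = map_prod e id (succ_conf c (K, N)))" for q N y
  proof -
    have "rstep R (q, N) y \<longleftrightarrow> (\<exists>K\<in>S. q = e K \<and> rstep (rules c e K) (q, N) y)"
      unfolding rstep_iff R_def by (blast dest: rules_state)
    also have "\<dots> \<longleftrightarrow> (\<exists>K\<in>S. q = e K \<and> rstep (rules c e K) (e K, N) y)"
      by blast
    finally show ?thesis unfolding rstep_rules_iff by blast
  qed
  have closed: "fst (succ_conf c (K, N)) \<in> S" if "K \<in> S" "K \<noteq> []" for K N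
    using S_closed that succ_conf_in_succ_progs by blast
  have steps: "\<exists>K\<in>S. q = e K \<and> (mstep c)\<^sup>*\<^sup>* (P, M) (K, N)"
    if "(rstep R)\<^sup>*\<^sup>* (0, M) (q, N)" for M q N
    using that
  proof (induction "(q, N)" arbitrary: q N rule: rtranclp_induct)
    case base
    then show ?case using S(3) by (intro bexI[of _ P]) (auto simp: e_def)
  next
    case (step y)
    obtain q1 N1 where y: "y = (q1, N1)" by fastforce
    with step.hyps(3) obtain K where K: "K \<in> S" "q1 = e K" "(mstep c)\<^sup>*\<^sup>* (P, M) (K, N1)" by blast
    from step.hyps(2) obtain L where
      L: "L \<in> S" "L \<noteq> []" "q1 = e L" "(q, N) = map_prod e id (succ_conf c (L, N1))"
      unfolding y rstep_R by blast
    with K(1,2) inj have "L = K" by (metis inj_onD)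
    with L have "K \<noteq> []" "(q, N) = map_prod e id (succ_conf c (K, N1))" by auto
    then obtain K' where K': "succ_conf c (K, N1) = (K', N)" "q = e K'"
      by (cases "succ_conf c (K, N1)") auto
    have "mstep c (K, N1) (K', N)" using K' \<open>K \<noteq> []\<close> by (simp add: mstep_def)
    moreover have "K' \<in> S" using closed[OF K(1) \<open>K \<noteq> []\<close>, of N1] K' by simp
    ultimately show ?case
      using K(3) K'(2) by (intro bexI[of _ K']) (auto intro: rtranclp.rtrancl_into_rtrancl)
  qed
  have steps': "(rstep R)\<^sup>*\<^sup>* (e K, M) (e K', N) \<and> K' \<in> S"
    if "(mstep c)\<^sup>*\<^sup>* (K, M) (K', N)" "K \<in> S" for K K' M N
    using that(1)
  proof (induction "(K', N)" arbitrary: K' N rule: rtranclp_induct)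
    case base
    then show ?case using that(2) by simp
  next
    case (step y)
    obtain L N1 where y: "y = (L, N1)" by fastforce
    with step.hyps(3) have L: "(rstep R)\<^sup>*\<^sup>* (e K, M) (e L, N1)" "L \<in> S" by auto
    from step.hyps(2) y have "L \<noteq> []" "succ_conf c (L, N1) = (K', N)" by (auto simp: mstep_def)
    with L(2) have "rstep R (e L, N1) (e K', N)" "K' \<in> S"
      unfolding rstep_R using closed[of L N1] by force+
    with L(1) show ?case by (meson rtranclp.rtrancl_into_rtrancl)
  qed
  interpret growing_system R h
  proof
    show "finite R" unfolding R_def using S(1) finite_rules by blast
    show "0 < k" if "((q, k, j), y) \<in> R" for q k j y
      using that rules_coeff_pos unfolding R_def by blast
    show "y = z" if "rstep R x y" "rstep R x z" for x y z
    proof -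
      obtain q N where x: "x = (q, N)" by fastforce
      from that obtain K L where "K \<in> S" "L \<in> S" "e K = e L"
        "y = map_prod e id (succ_conf c (K, N))" "z = map_prod e id (succ_conf c (L, N))"
        unfolding x rstep_R by metis
      then show ?thesis using inj by (metis inj_onD)
    qed
    show "N < N'" if st: "rstep R (q, N) (q', N')" and pos: "0 < N" for q N q' N'
    proof -
      from st obtain K where "K \<in> S" "K \<noteq> []" "snd (succ_conf c (K, N)) = N'"
        unfolding rstep_R by (metis snd_map_prod id_apply snd_conv)
      with succ_conf_grows[OF pos, of K B] S(4) show ?thesis unfolding c_def by simp
    qed
    show "\<not> rstep R (h, N) y" for N y
    proof
      assume "rstep R (h, N) y"
      then obtain K where "K \<in> S" "K \<noteq> []" "e [] = e K" unfolding rstep_R h_def by blast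
      then show False using inj_onD[OF inj _ S(2)] by metis
    qed
    show "\<exists>y. rstep R (q, N) y" if "(rstep R)\<^sup>*\<^sup>* (0, 2 ^ n) (q, N)" "q \<noteq> h" for n q N
    proof -
      from steps[OF that(1)] obtain K where "K \<in> S" "q = e K" by blast
      moreover from this that(2) have "K \<noteq> []" unfolding h_def by blast
      ultimately show ?thesis unfolding rstep_R by blast
    qed
  qed
  have "halts n \<longleftrightarrow> (\<exists>z. rec_eval f [n] z)" for n
  proof -
    let ?\<rho> = "(\<lambda>_. 0)(0 := n)"
    have "halts n \<longleftrightarrow> (\<exists>N. (mstep c)\<^sup>*\<^sup>* (P, 2 ^ n) ([], N))"
    proof
      assume "halts n"
      then obtain N where "(rstep R)\<^sup>*\<^sup>* (0, 2 ^ n) (e [], N)"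
        unfolding halts_def unfolding h_def ..
      from steps[OF this] obtain K where
        K: "K \<in> S" "e [] = e K" "(mstep c)\<^sup>*\<^sup>* (P, 2 ^ n) (K, N)" by blast
      with inj_onD[OF inj K(2) S(2)] show "\<exists>N. (mstep c)\<^sup>*\<^sup>* (P, 2 ^ n) ([], N)" by blast
    next
      assume "\<exists>N. (mstep c)\<^sup>*\<^sup>* (P, 2 ^ n) ([], N)"
      then obtain N where "(mstep c)\<^sup>*\<^sup>* (P, 2 ^ n) ([], N)" ..
      from steps'[OF this S(3)] have "(rstep R)\<^sup>*\<^sup>* (e P, 2 ^ n) (e [], N)" ..
      moreover have "e P = 0" by (simp add: e_def)
      ultimately show "halts n" unfolding halts_def unfolding h_def by auto
    qed
    also have "\<dots> \<longleftrightarrow> (\<exists>\<rho>'. exec P ?\<rho> \<rho>')"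
      using exec_imp_mstep[of P ?\<rho> _ B "2 ^ n"] mstep_imp_exec[of B P "2 ^ n" _ ?\<rho>]
        encodes_init[of B n] B unfolding c_def by blast
    finally show ?thesis using P by simp
  qed
  then show ?thesis using growing_system_axioms by blast
qed

section \<open>Computation histories as bit strings\<close>

text \<open>The state block has length \<open>Suc q\<close> because an empty one, in state 0, would
  create a run of three ones and blur the marker of the beginning.\<close>

fun conf :: "nat \<times> nat \<Rightarrow> bits" where
  "conf (q, N) = [True, True] @ replicate (Suc q) False @ [True] @ replicate N False"

lemma replicate_append_Cons_cancel:
  "replicate m False @ True # x = replicate n False @ True # y \<longleftrightarrow> m = n \<and> x = y"
proof (induction m arbitrary: n)
  case 0
  show ?case by (cases n) auto
next
  case (Suc m)
  then show ?case by (cases n) auto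
qed

text \<open>Unique decoding. The one that follows is essential: it ends the last block of zeros,
  whose length would otherwise be only a lower bound.\<close>

lemma conf_append_cancel:
  "conf x @ True # r = conf y @ True # s \<longleftrightarrow> x = y \<and> r = s"
  by (cases x; cases y) (auto simp: replicate_append_Cons_cancel)

lemma replicate_append_True_True:
  assumes "v @ True # True # r = replicate n False @ s"
  shows "\<exists>v'. v = replicate n False @ v' \<and> v' @ True # True # r = s"
  using assms
proof (induction n arbitrary: v)
  case (Suc n)
  then show ?case by (cases v) auto
qed simp

text \<open>
  Two adjacent ones occur only where a configuration begins. This needs \<open>N > 0\<close>, since the
  configuration \<open>(q, 0)\<close> ends in a one.
\<close>

lemma True_True_at_conf:
  assumes "v @ True # True # r = conf (q, N) @ s" "0 < N" "v \<noteq> []"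
  shows "\<exists>v'. v = conf (q, N) @ v' \<and> v' @ True # True # r = s"
proof -
  from assms(1,3) obtain w where w: "v = True # w"
    "w @ True # True # r = [True] @ replicate (Suc q) False @ [True] @ replicate N False @ s"
    by (cases v) auto
  from w(2) obtain w1 where w1: "w = True # w1"
    "w1 @ True # True # r = replicate (Suc q) False @ [True] @ replicate N False @ s"
    by (cases w) auto
  from replicate_append_True_True[OF w1(2)] obtain w2 where
    w2: "w1 = replicate (Suc q) False @ w2" "w2 @ True # True # r = [True] @ replicate N False @ s"
    by blast
  from w2(2) assms(2) obtain w3 where w3: "w2 = True # w3" "w3 @ True # True # r = replicate N False @ s"
    by (cases w2; cases N) auto
  from replicate_append_True_True[OF w3(2)] w w1(1) w2(1) w3(1) show ?thesis by auto
qed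

text \<open>Every configuration ends in a zero, its number being positive, so neither a junction nor
  the closing one of the history produces a further pair of ones.\<close>

lemma True_True_at_history:
  assumes "v @ True # True # r = concat (map conf cs) @ [True]" "\<forall>c\<in>set cs. 0 < snd c"
  shows "\<exists>as c bs. cs = as @ c # bs \<and> v = concat (map conf as)"
  using assms
proof (induction cs arbitrary: v)
  case Nil
  then show ?case by (cases v) auto
next
  case (Cons c cs)
  obtain q N where c: "c = (q, N)" by fastforce
  show ?case
  proof (cases "v = []")
    case True
    then show ?thesis by (intro exI[of _ "[]"]) auto
  next
    case False
    from True_True_at_conf[of v r q N "concat (map conf cs) @ [True]"] False Cons.prems c
    obtain v' where v': "v = conf c @ v'" "v' @ True # True # r = concat (map conf cs) @ [True]"
      by auto
    with Cons.IH[of v'] Cons.prems(2) obtain as d bs where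
      "cs = as @ d # bs" "v' = concat (map conf as)" by auto
    with v'(1) show ?thesis by (intro exI[of _ "c # as"]) auto
  qed
qed

text \<open>A substring test may find a configuration anywhere. Its leading pair of ones forces
  alignment with the history, and the one after it forces the last block to be complete.\<close>

lemma prefix_conf_history:
  assumes "v @ conf d @ True # r = concat (map conf cs) @ [True]" "\<forall>c\<in>set cs. 0 < snd c"
  shows "d \<in> set cs"
proof -
  obtain r' where "conf d @ True # r = True # True # r'" by (cases d) auto
  with assms True_True_at_history[of v r' cs] obtain as c bs where
    s: "cs = as @ c # bs" "v = concat (map conf as)" by auto
  with assms(1) have e: "conf d @ True # r = conf c @ concat (map conf bs) @ [True]" by auto
  obtain t where "concat (map conf bs) @ [True] = True # t"
    by (cases bs rule: list.exhaust; cases "hd bs") auto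
  with e have "d = c" by (simp add: conf_append_cancel)
  with s show ?thesis by simp
qed

section \<open>Words that witness halting\<close>

context growing_system
begin

text \<open>The conditions are local. They do not ask that \<open>u\<close> be a list of
  configurations, yet the chain that starts at the left end of \<open>u\<close> is forced to be a
  run.\<close>

definition history :: "nat \<Rightarrow> bits \<Rightarrow> bool" where
  "history n u \<longleftrightarrow> prefix (conf (0, 2 ^ n) @ [True]) u \<and>
    (\<forall>v. prefix (v @ [True, True]) u \<longrightarrow>
      prefix (v @ [True, True] @ replicate (Suc h) False @ [True]) u \<or>
      (\<exists>((q, k, j), (q', k', j'))\<in>R. \<exists>m.
        prefix (v @ conf (q, k * m + j) @ conf (q', k' * m + j') @ [True]) u))"

definition closed_word :: "nat \<Rightarrow> bits \<Rightarrow> bool" where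
  "closed_word n u \<longleftrightarrow> sublist (conf (0, 2 ^ n) @ [True]) u \<and>
    (\<forall>((q, k, j), (q', k', j'))\<in>R. \<forall>m. sublist (replicate m False) u \<longrightarrow>
      sublist (conf (q, k * m + j) @ [True]) u \<longrightarrow>
      sublist (conf (q', k' * m + j') @ [True]) u)"

text \<open>Following the chain from the left, each step moves strictly to the right in
  \<open>u\<close>. As \<open>u\<close> is finite, the rule alternative cannot apply forever, and
  the other one shows the halting state.\<close>

lemma history_imp_halts:
  assumes "history n u"
  shows "halts n"
proof -
  have "\<exists>N. (rstep R)\<^sup>*\<^sup>* x (h, N)" if "prefix (v @ conf x @ [True]) u" for v x
    using that
  proof (induction "length u - length v" arbitrary: v x rule: less_induct)
    case less
    obtain q N where x: "x = (q, N)" by fastforce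
    have conf_x: "conf x = [True, True] @ replicate (Suc q) False @ [True] @ replicate N False"
      by (simp add: x)
    from less.prems have "prefix (v @ [True, True]) u"
      unfolding conf_x by (auto simp: prefix_def)
    with assms consider
        (halted) "prefix (v @ [True, True] @ replicate (Suc h) False @ [True]) u"
      | (rule) p k j q' k' j' m where "((p, k, j), (q', k', j')) \<in> R"
        "prefix (v @ conf (p, k * m + j) @ conf (q', k' * m + j') @ [True]) u"
      unfolding history_def by blast
    then show ?case
    proof cases
      case halted
      with less.prems have "q = h"
        unfolding conf_x by (auto simp: prefix_def replicate_append_Cons_cancel)
      with x show ?thesis by blast
    next
      case rule
      let ?y = "(q', k' * m + j')"
      from less.prems obtain s where s: "u = v @ conf x @ True # s" by (auto simp: prefix_def)
      from rule(2) obtain t where t: "u = v @ conf (p, k * m + j) @ conf ?y @ True # t"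
        unfolding prefix_def by auto
      obtain t' where "conf ?y @ True # t = True # t'" by simp
      \<comment> \<open>Unique decoding identifies the left side of the matched rule with the
        configuration already known to stand at \<open>v\<close>.\<close>
      with s t have "x = (p, k * m + j)" by (simp only: append.assoc same_append_eq conf_append_cancel)
      then have st: "rstep R x ?y" "prefix ((v @ conf x) @ conf ?y @ [True]) u"
        using rule by (auto intro: rstep.intros)
      have "length u - length (v @ conf x) < length u - length v"
        using s x by simp
      from less.hyps[OF this st(2)] st(1) show ?thesis
        by (blast intro: converse_rtranclp_into_rtranclp)
    qed
  qed
  from this[of "[]"] assms show ?thesis unfolding halts_def history_def by simp
qed

lemma run_history:
  assumes "(rstep R)\<^sup>*\<^sup>* x (h, N)" "0 < snd x"
  shows "\<exists>cs. cs \<noteq> [] \<and> hd cs = x \<and> fst (last cs) = h \<and> successively (rstep R) cs \<and>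
    (\<forall>c\<in>set cs. 0 < snd c)"
  using assms
proof (induction rule: converse_rtranclp_induct)
  case base
  then show ?case by (intro exI[of _ "[(h, N)]"]) auto
next
  case (step x y)
  obtain q M q' M' where xy: "x = (q, M)" "y = (q', M')" by fastforce
  with grows step.hyps(1) step.prems have "0 < snd y" by fastforce
  with step.IH obtain cs where "cs \<noteq> []" "hd cs = y" "fst (last cs) = h"
    "successively (rstep R) cs" "\<forall>c\<in>set cs. 0 < snd c" by blast
  with step.hyps(1) step.prems show ?case
    by (intro exI[of _ "x # cs"]) (auto simp: successively_Cons)
qed

text \<open>The concatenated run serves both notions. For closure, an occurring left side is a
  member of the run; by determinism its image is the next member, and the last member has the
  halting state, to which no rule applies.\<close>

lemma halts_imp_history:
  assumes "halts n"
  shows "\<exists>u. history n u \<and> closed_word n u"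
proof -
  from assms obtain cs where cs: "cs \<noteq> []" "hd cs = (0, 2 ^ n)" "fst (last cs) = h"
    "successively (rstep R) cs" and pos: "\<forall>c\<in>set cs. 0 < snd c"
    using run_history[of "(0, 2 ^ n)"] unfolding halts_def by auto
  define u where "u = concat (map conf cs) @ [True]"
  \<comment> \<open>After every configuration there is a one, opening the next configuration or
    closing the word.\<close>
  have True_hd: "\<exists>t. concat (map conf bs) @ [True] = True # t" for bs
    by (cases bs) auto
  have start: "prefix (conf (0, 2 ^ n) @ [True]) u"
  proof -
    from cs(1,2) obtain ds where "cs = (0, 2 ^ n) # ds" by (cases cs) auto
    with True_hd[of ds] show ?thesis by (auto simp: u_def prefix_def)
  qed
  have "history n u"
    unfolding history_def
  proof (intro conjI start allI impI)
    fix v assume "prefix (v @ [True, True]) u"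
    then obtain r where "v @ True # True # r = concat (map conf cs) @ [True]"
      by (auto simp: prefix_def u_def)
    from True_True_at_history[OF this pos] obtain as c bs where
      s: "cs = as @ c # bs" "v = concat (map conf as)" by blast
    show "prefix (v @ [True, True] @ replicate (Suc h) False @ [True]) u \<or>
      (\<exists>((q, k, j), (q', k', j'))\<in>R. \<exists>m.
        prefix (v @ conf (q, k * m + j) @ conf (q', k' * m + j') @ [True]) u)"
    proof (cases bs)
      case Nil
      with s(1) cs(3) obtain N where "c = (h, N)" by (cases c) auto
      with s Nil show ?thesis by (auto simp: u_def prefix_def)
    next
      case (Cons d ds)
      with s(1) cs(4) have "rstep R c d" by (auto simp: successively_append_iff)
      then obtain q k j q' k' j' m where r: "((q, k, j), (q', k', j')) \<in> R"
        "c = (q, k * m + j)" "d = (q', k' * m + j')" by (blast elim: rstep.cases)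
      from True_hd[of ds] obtain t where "concat (map conf ds) @ [True] = True # t" ..
      with s Cons have "u = v @ conf c @ conf d @ [True] @ t" by (simp add: u_def)
      then have "prefix (v @ conf c @ conf d @ [True]) u" unfolding prefix_def by auto
      with r show ?thesis by fast
    qed
  qed
  moreover have "closed_word n u"
    unfolding closed_word_def
  proof (safe)
    show "sublist (conf (0, 2 ^ n) @ [True]) u"
      using start by (rule prefix_imp_sublist)
    fix q k j q' k' j' m
    assume R: "((q, k, j), (q', k', j')) \<in> R" and "sublist (conf (q, k * m + j) @ [True]) u"
    then obtain v r where "v @ conf (q, k * m + j) @ True # r = concat (map conf cs) @ [True]"
      by (auto simp: sublist_def u_def)
    with prefix_conf_history pos have c: "(q, k * m + j) \<in> set cs" by blast
    then obtain as bs where s: "cs = as @ (q, k * m + j) # bs" by (meson split_list)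
    let ?d = "(q', k' * m + j')"
    have st: "rstep R (q, k * m + j) ?d" using R by (rule rstep.intros)
    show "sublist (conf ?d @ [True]) u"
    proof (cases bs)
      case Nil
      with s cs(3) have "q = h" by simp
      with st halted show ?thesis by blast
    next
      case (Cons d ds)
      with s cs(4) have "rstep R (q, k * m + j) d" by (auto simp: successively_append_iff)
      with st deterministic have "d = ?d" by blast
      from True_hd[of ds] obtain t where "concat (map conf ds) @ [True] = True # t" ..
      with s Cons \<open>d = ?d\<close> have "u = (concat (map conf as) @ conf (q, k * m + j)) @ (conf ?d @ [True]) @ t"
        by (simp add: u_def)
      then show ?thesis unfolding sublist_def by blast
    qed
  qed
  ultimately show ?thesis by blast
qed

text \<open>The measure is the gap between \<open>length u\<close> and the current number: the
  number grows, and its block of zeros must still fit into \<open>u\<close>. Reachability is part of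
  the induction because \<open>progress\<close> speaks of reachable configurations.\<close>

lemma closed_word_imp_halts:
  assumes "closed_word n u"
  shows "halts n"
proof -
  have "\<exists>N. (rstep R)\<^sup>*\<^sup>* x (h, N)"
    if "(rstep R)\<^sup>*\<^sup>* (0, 2 ^ n) x" "sublist (conf x @ [True]) u" "0 < snd x" for x
    using that
  proof (induction "length u - snd x" arbitrary: x rule: less_induct)
    case less
    obtain q N where x: "x = (q, N)" by fastforce
    show ?case
    proof (cases "q = h")
      case True
      with x show ?thesis by blast
    next
      case False
      with progress less.prems(1) x obtain y where y: "rstep R x y" by blast
      obtain q' N' where y': "y = (q', N')" by fastforce
      from y obtain p k j p' k' j' m where r: "((p, k, j), (p', k', j')) \<in> R"
        "x = (p, k * m + j)" "y = (p', k' * m + j')" by (blast elim: rstep.cases)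
      \<comment> \<open>As k is positive, the block of length m lies inside the last block of the
        configuration, hence m is in the range of the bounded quantifier.\<close>
      have "m \<le> k * m + j" using coeff_pos[OF r(1)] by (simp add: trans_le_add1)
      then obtain l where "replicate (k * m + j) False = replicate m False @ replicate l False"
        by (metis le_Suc_ex replicate_add)
      then have "sublist (replicate m False) (conf x)"
        unfolding r(2) conf.simps sublist_def by (metis append.assoc append_Nil2)
      with less.prems(2) have "sublist (replicate m False) u"
        by (meson sublist_append_rightI sublist_order.order_trans)
      with assms r less.prems(2) have c: "sublist (conf y @ [True]) u"
        unfolding closed_word_def by blast
      have "N < N'" using grows[of q N q' N'] y x y' less.prems(3) by simp
      moreover have "N' < length u"
        using sublist_length_le[OF c] y' by simp
      ultimately have "length u - snd y < length u - snd x" "0 < snd y" using x y' by auto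
      with less.hyps[of y] c y less.prems(1) show ?thesis
        by (meson converse_rtranclp_into_rtranclp rtranclp.rtrancl_into_rtrancl)
    qed
  qed
  from this[of "(0, 2 ^ n)"] assms show ?thesis unfolding halts_def closed_word_def by simp
qed

end

section \<open>Recursiveness of the coding\<close>

definition recursive :: "nat \<Rightarrow> (nat list \<Rightarrow> nat) \<Rightarrow> bool" where
  "recursive k F \<longleftrightarrow> (\<exists>g. \<forall>xs. length xs = k \<longrightarrow> rec_eval g xs (F xs))"

lemma recursive_nth: "i < k \<Longrightarrow> recursive k (\<lambda>xs. xs ! i)"
  unfolding recursive_def by (metis rec_proj)

lemma recursive_compose:
  assumes "recursive (length Gs) F" "\<And>G. G \<in> set Gs \<Longrightarrow> recursive k G"
  shows "recursive k (\<lambda>xs. F (map (\<lambda>G. G xs) Gs))"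
proof -
  from assms(1) obtain f where f: "\<And>xs. length xs = length Gs \<Longrightarrow> rec_eval f xs (F xs)"
    unfolding recursive_def by blast
  from assms(2) obtain g where
    g: "\<And>G xs. G \<in> set Gs \<Longrightarrow> length xs = k \<Longrightarrow> rec_eval (g G) xs (G xs)"
    unfolding recursive_def by metis
  have "rec_eval (Comp f (map g Gs)) xs (F (map (\<lambda>G. G xs) Gs))" if "length xs = k" for xs
    using that by (intro rec_comp[where ys = "map (\<lambda>G. G xs) Gs"]) (auto intro: f g)
  then show ?thesis unfolding recursive_def by blast
qed

lemma recursive_compose1:
  "recursive 1 (\<lambda>xs. f (xs ! 0)) \<Longrightarrow> recursive k G \<Longrightarrow> recursive k (\<lambda>xs. f (G xs))"
  using recursive_compose[of "[G]" "\<lambda>xs. f (xs ! 0)" k] by simp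

lemma recursive_compose2:
  "recursive 2 (\<lambda>xs. f (xs ! 0) (xs ! 1)) \<Longrightarrow> recursive k G \<Longrightarrow> recursive k H \<Longrightarrow>
    recursive k (\<lambda>xs. f (G xs) (H xs))"
  using recursive_compose[of "[G, H]" "\<lambda>xs. f (xs ! 0) (xs ! 1)" k] by (auto simp: numeral_2_eq_2)

lemma recursive_rec_nat:
  assumes "recursive k F" "recursive (Suc (Suc k)) G"
  shows "recursive (Suc k) (\<lambda>xs. rec_nat (F (tl xs)) (\<lambda>n r. G (n # r # tl xs)) (xs ! 0))"
proof -
  from assms obtain f g where f: "\<And>xs. length xs = k \<Longrightarrow> rec_eval f xs (F xs)"
    and g: "\<And>xs. length xs = Suc (Suc k) \<Longrightarrow> rec_eval g xs (G xs)"
    unfolding recursive_def by metis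
  have "rec_eval (PrimRec f g) (n # xs) (rec_nat (F xs) (\<lambda>n r. G (n # r # xs)) n)"
    if "length xs = k" for n xs
    using that by (induction n) (auto intro!: rec_prim_0 rec_prim_Suc f g)
  then show ?thesis unfolding recursive_def
    by (intro exI[of _ "PrimRec f g"]) (auto simp: length_Suc_conv)
qed

lemma recursive_Suc: "recursive k G \<Longrightarrow> recursive k (\<lambda>xs. Suc (G xs))"
proof (rule recursive_compose1[of Suc])
  show "recursive 1 (\<lambda>xs. Suc (xs ! 0))"
    unfolding recursive_def by (intro exI[of _ Succ]) (auto simp: length_Suc_conv intro: rec_succ)
qed

lemma recursive_const: "recursive k (\<lambda>_. n)"
proof (induction n)
  case 0
  show ?case unfolding recursive_def by (blast intro: rec_zero)
qed (rule recursive_Suc)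

lemma recursive_add:
  "recursive k F \<Longrightarrow> recursive k G \<Longrightarrow> recursive k (\<lambda>xs. F xs + G xs)"
proof (rule recursive_compose2[where f = "(+)"])
  have "rec_nat m (\<lambda>n r. Suc r) n = n + m" for m n :: nat
    by (induction n) auto
  moreover have "recursive (Suc (Suc 0)) (\<lambda>xs. rec_nat ((\<lambda>ys. ys ! 0) (tl xs))
      (\<lambda>n r. (\<lambda>ys. Suc (ys ! 1)) (n # r # tl xs)) (xs ! 0))"
    by (intro recursive_rec_nat recursive_Suc recursive_nth) auto
  ultimately show "recursive 2 (\<lambda>xs. xs ! 0 + xs ! 1)"
    unfolding recursive_def by (auto simp: numeral_2_eq_2 nth_tl)
qed

lemma recursive_triangle: "recursive k F \<Longrightarrow> recursive k (\<lambda>xs. triangle (F xs))"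
proof (rule recursive_compose1[where f = triangle])
  have "rec_nat 0 (\<lambda>n r. r + Suc n) n = triangle n" for n
    by (induction n) auto
  moreover have "recursive (Suc 0) (\<lambda>xs. rec_nat ((\<lambda>_. 0) (tl xs))
      (\<lambda>n r. (\<lambda>ys. ys ! 1 + Suc (ys ! 0)) (n # r # tl xs)) (xs ! 0))"
    by (intro recursive_rec_nat recursive_add recursive_Suc recursive_nth recursive_const) auto
  ultimately show "recursive 1 (\<lambda>xs. triangle (xs ! 0))"
    unfolding recursive_def by simp
qed

lemma recursive_prod_encode:
  "recursive k F \<Longrightarrow> recursive k G \<Longrightarrow> recursive k (\<lambda>xs. prod_encode (F xs, G xs))"
  unfolding prod_encode_def prod.case by (intro recursive_add recursive_triangle)

text \<open>
  Diagonalisation needs no universal machine: a formula \<open>\<phi>\<close> represents the halting of a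
  program \<open>d\<close> on every input, in particular on the code of \<open>\<phi>\<close> itself.
\<close>

lemma undecidable_fragmentI:
  assumes rec: "recursive 1 (\<lambda>xs. fm_code (\<iota> (xs ! 0)))"
    and represents: "\<And>d. \<exists>\<phi>. \<forall>n. Ex 0 (And (\<iota> n) \<phi>) \<in> Sigma_sentences a b c \<and>
      (true_in \<AA> (Ex 0 (And (\<iota> n) \<phi>)) \<longleftrightarrow> (\<exists>z. rec_eval d [n] z))"
  shows "undecidable_fragment a b c \<AA>"
  unfolding undecidable_fragment_def
proof
  assume "decidable_within (Sigma_sentences a b c) (Sigma_true a b c \<AA>)"
  then obtain f where f: "\<phi> \<in> Sigma_sentences a b c \<Longrightarrow>
      rec_eval f [fm_code \<phi>] (if \<phi> \<in> Sigma_true a b c \<AA> then 1 else 0)" for \<phi>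
    unfolding decidable_within_def by blast
  \<comment> \<open>8 and 4 are the tags of \<open>Ex\<close> and \<open>And\<close>. The final
    \<open>n\<close> stands where the code of the second conjunct belongs; for
    \<open>n = fm_code \<phi>\<close> this is the code of the sentence about input
    \<open>n\<close>.\<close>
  let ?code = "\<lambda>n. prod_encode (8, prod_encode (0,
      prod_encode (4, prod_encode (fm_code (\<iota> n), n))))"
  have "recursive 2 (\<lambda>xs. ?code (xs ! 1))"
    by (intro recursive_prod_encode recursive_const recursive_nth
        recursive_compose1[OF rec, of 2 "\<lambda>xs. xs ! 1"]) auto
  then obtain s where "\<And>xs. length xs = 2 \<Longrightarrow> rec_eval s xs (?code (xs ! 1))"
    unfolding recursive_def by blast
  from this[of "[i, n]" for i n] have s: "rec_eval s [i, n] (?code n)" for i n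
    by simp
  \<comment> \<open>\<open>s\<close> ignores the search variable, so the search stops at once if
    \<open>f\<close> answers 0 and never if it answers 1: \<open>d\<close> halts on \<open>n\<close>
    exactly when the sentence is judged false.\<close>
  define d where "d = Mu (Comp f [s])"
  obtain \<phi> where \<phi>: "Ex 0 (And (\<iota> n) \<phi>) \<in> Sigma_sentences a b c"
    "true_in \<AA> (Ex 0 (And (\<iota> n) \<phi>)) \<longleftrightarrow> (\<exists>z. rec_eval d [n] z)" for n
    using represents[of d] by blast
  define n where "n = fm_code \<phi>"
  define \<psi> where "\<psi> = Ex 0 (And (\<iota> n) \<phi>)"
  let ?b = "if true_in \<AA> \<psi> then 1 else 0 :: nat"
  have "rec_eval f [?code n] ?b"
    using f[OF \<phi>(1)[of n]] \<phi>(1)[of n] by (simp add: n_def \<psi>_def Sigma_true_def)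
  then have b: "rec_eval (Comp f [s]) [i, n] ?b" for i
    using s[of i n] by (intro rec_comp[where ys = "[?code n]"]) auto
  have "(\<exists>z. rec_eval d [n] z) \<longleftrightarrow> \<not> true_in \<AA> \<psi>"
  proof
    assume "\<exists>z. rec_eval d [n] z"
    then obtain z where "rec_eval (Comp f [s]) [z, n] 0"
      unfolding d_def by (auto elim: rec_muE)
    with b[of z] have "?b = 0" by (rule rec_eval_deterministic)
    then show "\<not> true_in \<AA> \<psi>" by (simp split: if_splits)
  next
    assume "\<not> true_in \<AA> \<psi>"
    with b[of 0] have "rec_eval (Comp f [s]) [0, n] 0" by simp
    then have "rec_eval d [n] 0" unfolding d_def by (intro rec_mu) auto
    then show "\<exists>z. rec_eval d [n] z" ..
  qed
  with \<phi>(2)[of n] show False unfolding \<psi>_def by blast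
qed


section \<open>The sentences\<close>

primrec trm_power :: "trm \<Rightarrow> nat \<Rightarrow> trm" where
  "trm_power t 0 = ConstE"
| "trm_power t (Suc k) = Conc t (trm_power t k)"

lemma trm_vars_power: "trm_vars (trm_power t k) \<subseteq> trm_vars t"
  by (induction k) auto

lemma trm_val_power:
  "trm_val (bits_structure r) \<sigma> (trm_power t k) =
    concat (replicate k (trm_val (bits_structure r) \<sigma> t))"
  by (induction k) (auto simp: bits_structure_def)

text \<open>Repeated squaring makes the code of \<open>zeros n\<close> a primitive recursive function of \<open>n\<close>.\<close>

primrec zeros :: "nat \<Rightarrow> trm" where
  "zeros 0 = Const0"
| "zeros (Suc n) = Conc (zeros n) (zeros n)"

lemma trm_vars_zeros [simp]: "trm_vars (zeros n) = {}"
  by (induction n) auto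

lemma trm_val_zeros: "trm_val (bits_structure r) \<sigma> (zeros n) = replicate (2 ^ n) False"
  by (induction n) (auto simp: bits_structure_def replicate_add[symmetric] mult_2)

definition trm_11 :: trm where
  "trm_11 = Conc Const1 Const1"

definition state_trm :: "nat \<Rightarrow> trm" where
  "state_trm q = Conc trm_11 (Conc (trm_power Const0 (Suc q)) Const1)"

definition start_trm :: "nat \<Rightarrow> trm" where
  "start_trm n = Conc (Conc (state_trm 0) (zeros n)) Const1"

fun conf_trm :: "nat \<times> nat \<times> nat \<Rightarrow> nat \<Rightarrow> trm" where
  "conf_trm (q, k, j) x = Conc (state_trm q) (Conc (trm_power (Var x) k) (trm_power Const0 j))"

lemma trm_vars_simps [simp]:
  "trm_vars trm_11 = {}"
  "trm_vars (state_trm q) = {}"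
  "trm_vars (start_trm n) = {}"
  using trm_vars_power[of Const0] by (auto simp: trm_11_def state_trm_def start_trm_def)

lemma trm_vars_conf: "trm_vars (conf_trm c x) \<subseteq> {x}"
  using trm_vars_power[of Const0] trm_vars_power[of "Var x"] by (cases c) auto

lemma concat_replicate_singleton [simp]: "concat (replicate k [x]) = replicate k x"
  by (induction k) auto

lemma concat_replicate_replicate: "concat (replicate k (replicate m x)) = replicate (k * m) x"
  by (induction k) (auto simp: replicate_add)

lemma trm_val_11: "trm_val (bits_structure r) \<sigma> trm_11 = [True, True]"
  by (simp add: trm_11_def bits_structure_def)

lemma trm_val_state:
  "trm_val (bits_structure r) \<sigma> (state_trm q) = [True, True] @ replicate (Suc q) False @ [True]"
  using trm_val_power[of r \<sigma> Const0 "Suc q"]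
  by (simp add: state_trm_def trm_11_def bits_structure_def)

lemma trm_val_start: "trm_val (bits_structure r) \<sigma> (start_trm n) = conf (0, 2 ^ n) @ [True]"
  using trm_val_state[of r \<sigma> 0] trm_val_zeros[of r \<sigma> n]
  by (simp add: start_trm_def bits_structure_def)

lemma trm_val_conf:
  "\<sigma> x = replicate m False \<Longrightarrow>
    trm_val (bits_structure r) \<sigma> (conf_trm (q, k, j) x) = conf (q, k * m + j)"
  using trm_val_state[of r \<sigma> q] trm_val_power[of r \<sigma> "Var x" k] trm_val_power[of r \<sigma> Const0 j]
  by (simp add: bits_structure_def concat_replicate_replicate replicate_add)

lemma recursive_start_trm: "recursive 1 (\<lambda>xs. trm_code (start_trm (xs ! 0)))"
proof -
  have "recursive (Suc 0) (\<lambda>xs. rec_nat ((\<lambda>_. trm_code Const0) (tl xs))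
      (\<lambda>n r. (\<lambda>ys. prod_encode (4, prod_encode (ys ! 1, ys ! 1))) (n # r # tl xs)) (xs ! 0))"
    by (intro recursive_rec_nat recursive_prod_encode recursive_nth recursive_const) auto
  moreover have "rec_nat (trm_code Const0) (\<lambda>n r. prod_encode (4, prod_encode (r, r))) n =
      trm_code (zeros n)" for n
    by (induction n) auto
  ultimately have "recursive 1 (\<lambda>xs. trm_code (zeros (xs ! 0)))" by simp
  then show ?thesis
    by (auto simp: start_trm_def intro!: recursive_prod_encode recursive_const)
qed

lemma commute_False_iff: "v @ [False] = False # v \<longleftrightarrow> (\<exists>m. v = replicate m False)"
proof
  assume "v @ [False] = False # v"
  then show "\<exists>m. v = replicate m False"
  proof (induction v)
    case Nil
    show ?case by (intro exI[of _ 0]) simp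
  next
    case (Cons b v)
    then obtain m where "\<not> b" "v = replicate m False" by auto
    then show ?case by (intro exI[of _ "Suc m"]) simp
  qed
qed (auto simp: replicate_append_same)

definition zero_block :: "nat \<Rightarrow> fm" where
  "zero_block x = Eq (Conc (Var x) Const0) (Conc Const0 (Var x))"

definition not_zero_block :: "nat \<Rightarrow> fm" where
  "not_zero_block x = NotEq (Conc (Var x) Const0) (Conc Const0 (Var x))"

lemma sat_zero_block:
  "sat (bits_structure r) \<sigma> (zero_block x) \<longleftrightarrow> (\<exists>m. \<sigma> x = replicate m False)"
  "sat (bits_structure r) \<sigma> (not_zero_block x) \<longleftrightarrow> (\<nexists>m. \<sigma> x = replicate m False)"
  by (simp_all add: zero_block_def not_zero_block_def bits_structure_def commute_False_iff)

section \<open>Quantifier-free matrices\<close>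

definition big_or :: "fm list \<Rightarrow> fm" where
  "big_or fs = foldr Or fs (NotEq ConstE ConstE)"

definition big_and :: "fm list \<Rightarrow> fm" where
  "big_and fs = foldr And fs (Eq ConstE ConstE)"

lemma sat_big_or: "sat \<AA> \<sigma> (big_or fs) \<longleftrightarrow> (\<exists>\<phi>\<in>set fs. sat \<AA> \<sigma> \<phi>)"
  by (induction fs) (auto simp: big_or_def)

lemma sat_big_and: "sat \<AA> \<sigma> (big_and fs) \<longleftrightarrow> (\<forall>\<phi>\<in>set fs. sat \<AA> \<sigma> \<phi>)"
  by (induction fs) (auto simp: big_and_def)

definition matrix :: "nat set \<Rightarrow> fm \<Rightarrow> bool" where
  "matrix V \<phi> \<longleftrightarrow> sigma_formula \<phi> \<and> free_vars \<phi> \<subseteq> V \<and>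
    count_ex \<phi> = 0 \<and> count_bex \<phi> = 0 \<and> count_ball \<phi> = 0"

lemma matrix_simps [simp]:
  "matrix V (Le s t) \<longleftrightarrow> trm_vars s \<subseteq> V \<and> trm_vars t \<subseteq> V"
  "matrix V (NotLe s t) \<longleftrightarrow> trm_vars s \<subseteq> V \<and> trm_vars t \<subseteq> V"
  "matrix V (Eq s t) \<longleftrightarrow> trm_vars s \<subseteq> V \<and> trm_vars t \<subseteq> V"
  "matrix V (NotEq s t) \<longleftrightarrow> trm_vars s \<subseteq> V \<and> trm_vars t \<subseteq> V"
  "matrix V (And \<phi> \<psi>) \<longleftrightarrow> matrix V \<phi> \<and> matrix V \<psi>"
  "matrix V (Or \<phi> \<psi>) \<longleftrightarrow> matrix V \<phi> \<and> matrix V \<psi>"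
  "matrix V (zero_block x) \<longleftrightarrow> x \<in> V"
  "matrix V (not_zero_block x) \<longleftrightarrow> x \<in> V"
  by (auto simp: matrix_def zero_block_def not_zero_block_def)

lemma matrix_big_or [simp]: "matrix V (big_or fs) \<longleftrightarrow> (\<forall>\<phi>\<in>set fs. matrix V \<phi>)"
  by (induction fs) (auto simp: big_or_def)

lemma matrix_big_and [simp]: "matrix V (big_and fs) \<longleftrightarrow> (\<forall>\<phi>\<in>set fs. matrix V \<phi>)"
  by (induction fs) (auto simp: big_and_def)

text \<open>Variable 0 is the word \<open>u\<close>, 1 the prefix \<open>v\<close>, 2 the block of
  zeros, and 3, in the length structure, the remainder after a matched prefix. In the formulas for
  \<open>struct_B\<close> the block is variable 1.\<close>

abbreviation (input) steps_trm :: "rule \<Rightarrow> trm" where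
  "steps_trm \<rho> \<equiv> Conc (Var 1) (Conc (conf_trm (fst \<rho>) 2) (Conc (conf_trm (snd \<rho>) 2) Const1))"

definition step_D :: "rule \<Rightarrow> fm" where
  "step_D \<rho> = And (zero_block 2) (Le (steps_trm \<rho>) (Var 0))"

text \<open>All rules share variable 2: only one disjunct has to hold, so one witness for the block
  is enough.\<close>

definition matrix_D :: "nat \<Rightarrow> rule list \<Rightarrow> fm" where
  "matrix_D h rs = Or (NotLe (Conc (Var 1) trm_11) (Var 0))
     (Or (Le (Conc (Var 1) (state_trm h)) (Var 0)) (big_or (map step_D rs)))"

definition step_B :: "rule \<Rightarrow> fm" where
  "step_B \<rho> = Or (NotLe (Conc (conf_trm (fst \<rho>) 1) Const1) (Var 0))
     (Le (Conc (conf_trm (snd \<rho>) 1) Const1) (Var 0))"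

definition matrix_B :: "rule list \<Rightarrow> fm" where
  "matrix_B rs = Or (not_zero_block 1) (big_and (map step_B rs))"

definition step_F :: "rule \<Rightarrow> fm" where
  "step_F \<rho> = And (zero_block 2) (Eq (Conc (steps_trm \<rho>) (Var 3)) (Var 0))"

text \<open>
  The second disjunct states that the prefix of \<open>u\<close> of length \<open>|v| + 2\<close> differs from \<open>v11\<close>.
\<close>

definition matrix_F :: "nat \<Rightarrow> rule list \<Rightarrow> fm" where
  "matrix_F h rs = Or (NotLe (Conc (Var 1) trm_11) (Var 0))
     (Or (And (Eq (Conc (Var 2) (Var 3)) (Var 0))
           (And (And (Le (Var 2) (Conc (Var 1) trm_11)) (Le (Conc (Var 1) trm_11) (Var 2)))
             (NotEq (Var 2) (Conc (Var 1) trm_11))))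
       (Or (Eq (Conc (Conc (Var 1) (state_trm h)) (Var 3)) (Var 0)) (big_or (map step_F rs))))"

lemma matrix_matrix:
  "matrix {0, 1, 2} (matrix_D h rs)"
  "matrix {0, 1} (matrix_B rs)"
  "matrix {0, 1, 2, 3} (matrix_F h rs)"
proof -
  have "trm_vars (conf_trm c 2) \<subseteq> {0, 1, 2}" "trm_vars (conf_trm c 2) \<subseteq> {0, 1, 2, 3}"
    "trm_vars (conf_trm c 1) \<subseteq> {0, 1}" for c
    using trm_vars_conf by blast+
  then show "matrix {0, 1, 2} (matrix_D h rs)" "matrix {0, 1} (matrix_B rs)"
    "matrix {0, 1, 2, 3} (matrix_F h rs)"
    by (simp_all add: matrix_D_def matrix_B_def matrix_F_def step_D_def step_B_def step_F_def)
qed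

text \<open>Only the first conjunct under the outer quantifier mentions \<open>n\<close>, the shape
  that the diagonal argument demands.\<close>

definition sentence_D :: "nat \<Rightarrow> nat \<Rightarrow> rule list \<Rightarrow> fm" where
  "sentence_D n h rs = Ex 0 (And (Le (start_trm n) (Var 0))
     (BAll 1 (Var 0) (Ex 2 (matrix_D h rs))))"

definition sentence_B :: "nat \<Rightarrow> rule list \<Rightarrow> fm" where
  "sentence_B n rs = Ex 0 (And (Le (start_trm n) (Var 0)) (BAll 1 (Var 0) (matrix_B rs)))"

text \<open>The last conjunct only brings the number of bounded universal quantifiers to two.\<close>

definition sentence_F :: "nat \<Rightarrow> nat \<Rightarrow> rule list \<Rightarrow> fm" where
  "sentence_F n h rs = Ex 0 (And (BEx 1 (Var 0) (Eq (Conc (start_trm n) (Var 1)) (Var 0)))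
     (And (BAll 1 (Var 0) (BEx 2 (Var 0) (BEx 3 (Var 0) (matrix_F h rs))))
       (BAll 1 ConstE (Eq ConstE ConstE))))"

lemma sentences:
  "sentence_D n h rs \<in> Sigma_sentences 2 0 1"
  "sentence_B n rs \<in> Sigma_sentences 1 0 1"
  "sentence_F n h rs \<in> Sigma_sentences 1 3 2"
  using matrix_matrix(1,3)[of h rs] matrix_matrix(2)[of rs]
  by (auto simp: sentence_D_def sentence_B_def sentence_F_def Sigma_sentences_def matrix_def)

section \<open>Meaning of the matrices\<close>

lemma bits_structure_simps:
  "i_0 (bits_structure r) = [False]" "i_1 (bits_structure r) = [True]"
  "i_e (bits_structure r) = []" "i_conc (bits_structure r) = (@)" "i_le (bits_structure r) = r"
  by (simp_all add: bits_structure_def)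

definition inst :: "nat \<times> nat \<times> nat \<Rightarrow> nat \<Rightarrow> nat \<times> nat" where
  "inst c m = (fst c, fst (snd c) * m + snd (snd c))"

lemma trm_val_conf_inst:
  "\<sigma> x = replicate m False \<Longrightarrow> trm_val (bits_structure r) \<sigma> (conf_trm c x) = conf (inst c m)"
  using trm_val_conf[of \<sigma> x m r "fst c" "fst (snd c)" "snd (snd c)"]
  by (simp add: inst_def)

lemma sat_step_D:
  "sat struct_D \<sigma> (step_D \<rho>) \<longleftrightarrow> (\<exists>m. \<sigma> 2 = replicate m False \<and>
     prefix (\<sigma> 1 @ conf (inst (fst \<rho>) m) @ conf (inst (snd \<rho>) m) @ [True]) (\<sigma> 0))"
  unfolding struct_D_def step_D_def sat.simps sat_zero_block
  by (auto simp: trm_val_conf_inst bits_structure_simps simp del: conf_trm.simps)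

lemma sat_matrix_D:
  "sat struct_D \<sigma> (matrix_D h rs) \<longleftrightarrow> \<not> prefix (\<sigma> 1 @ [True, True]) (\<sigma> 0) \<or>
     prefix (\<sigma> 1 @ [True, True] @ replicate (Suc h) False @ [True]) (\<sigma> 0) \<or>
     (\<exists>\<rho>\<in>set rs. sat struct_D \<sigma> (step_D \<rho>))"
  unfolding matrix_D_def sat.simps sat_big_or
  by (simp add: struct_D_def trm_val_11 trm_val_state bits_structure_simps)

lemma sat_step_B:
  "\<sigma> 1 = replicate m False \<Longrightarrow> sat struct_B \<sigma> (step_B \<rho>) \<longleftrightarrow>
    (sublist (conf (inst (fst \<rho>) m) @ [True]) (\<sigma> 0) \<longrightarrow>
     sublist (conf (inst (snd \<rho>) m) @ [True]) (\<sigma> 0))"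
  unfolding struct_B_def step_B_def sat.simps
  by (auto simp: trm_val_conf_inst bits_structure_simps simp del: conf_trm.simps)

lemma sat_matrix_B:
  "sat struct_B \<sigma> (matrix_B rs) \<longleftrightarrow> (\<forall>m. \<sigma> 1 = replicate m False \<longrightarrow>
     (\<forall>\<rho>\<in>set rs. sublist (conf (inst (fst \<rho>) m) @ [True]) (\<sigma> 0) \<longrightarrow>
       sublist (conf (inst (snd \<rho>) m) @ [True]) (\<sigma> 0)))"
proof -
  have "sat struct_B \<sigma> (not_zero_block 1) \<longleftrightarrow> (\<nexists>m. \<sigma> 1 = replicate m False)"
    unfolding struct_B_def by (rule sat_zero_block)
  then show ?thesis
    unfolding matrix_B_def sat.simps sat_big_and set_map ball_simps using sat_step_B[of \<sigma>] by blast
qed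

lemma sat_step_F:
  "sat struct_F \<sigma> (step_F \<rho>) \<longleftrightarrow> (\<exists>m. \<sigma> 2 = replicate m False \<and>
     (\<sigma> 1 @ conf (inst (fst \<rho>) m) @ conf (inst (snd \<rho>) m) @ [True]) @ \<sigma> 3 = \<sigma> 0)"
  unfolding struct_F_def step_F_def sat.simps sat_zero_block
  by (auto simp: trm_val_conf_inst bits_structure_simps simp del: conf_trm.simps)

lemma sat_matrix_F:
  "sat struct_F \<sigma> (matrix_F h rs) \<longleftrightarrow> length (\<sigma> 0) < length (\<sigma> 1 @ [True, True]) \<or>
     \<sigma> 2 @ \<sigma> 3 = \<sigma> 0 \<and> length (\<sigma> 2) = length (\<sigma> 1 @ [True, True]) \<and> \<sigma> 2 \<noteq> \<sigma> 1 @ [True, True] \<or>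
     (\<sigma> 1 @ [True, True] @ replicate (Suc h) False @ [True]) @ \<sigma> 3 = \<sigma> 0 \<or>
     (\<exists>\<rho>\<in>set rs. sat struct_F \<sigma> (step_F \<rho>))"
  unfolding matrix_F_def sat.simps sat_big_or
  by (auto simp: struct_F_def trm_val_11 trm_val_state bits_structure_simps)

section \<open>Truth of the sentences is halting\<close>

context growing_system
begin

lemma history_inst_iff:
  "history n u \<longleftrightarrow> prefix (conf (0, 2 ^ n) @ [True]) u \<and>
    (\<forall>v. prefix (v @ [True, True]) u \<longrightarrow>
      prefix (v @ [True, True] @ replicate (Suc h) False @ [True]) u \<or>
      (\<exists>\<rho>\<in>R. \<exists>m. prefix (v @ conf (inst (fst \<rho>) m) @ conf (inst (snd \<rho>) m) @ [True]) u))"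
  unfolding history_def inst_def case_prod_beta ..

lemma closed_word_inst_iff:
  "closed_word n u \<longleftrightarrow> sublist (conf (0, 2 ^ n) @ [True]) u \<and>
    (\<forall>\<rho>\<in>R. \<forall>m. sublist (replicate m False) u \<longrightarrow>
      sublist (conf (inst (fst \<rho>) m) @ [True]) u \<longrightarrow>
      sublist (conf (inst (snd \<rho>) m) @ [True]) u)"
  unfolding closed_word_def inst_def case_prod_beta ..

lemma true_sentence_D:
  assumes "set rs = R"
  shows "true_in struct_D (sentence_D n h rs) \<longleftrightarrow> halts n"
proof -
  have main: "sat struct_D \<sigma> (BAll 1 (Var 0) (Ex 2 (matrix_D h rs))) \<longleftrightarrow>
      (\<forall>v. prefix (v @ [True, True]) (\<sigma> 0) \<longrightarrow>
        prefix (v @ [True, True] @ replicate (Suc h) False @ [True]) (\<sigma> 0) \<or>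
        (\<exists>\<rho>\<in>R. \<exists>m. prefix (v @ conf (inst (fst \<rho>) m) @ conf (inst (snd \<rho>) m) @ [True]) (\<sigma> 0)))"
    for \<sigma>
  proof -
    \<comment> \<open>The bounded quantifier ranges over prefixes of \<open>u\<close>; this loses
      nothing, since a \<open>v\<close> that is not a prefix makes the premise of the history
      condition false.\<close>
    have "prefix v u" if "prefix (v @ [True, True]) u" for u v :: bits
      using that by (rule append_prefixD)
    then show ?thesis
      unfolding sat.simps sat_matrix_D sat_step_D assms
      by (simp add: struct_D_def bits_structure_simps) blast
  qed
  have start: "sat struct_D \<sigma> (Le (start_trm n) (Var 0)) \<longleftrightarrow>
      prefix (conf (0, 2 ^ n) @ [True]) (\<sigma> 0)" for \<sigma>
    by (simp add: struct_D_def trm_val_start bits_structure_simps del: conf.simps)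
  have "sat struct_D \<sigma> (sentence_D n h rs) \<longleftrightarrow> (\<exists>u. history n u)" for \<sigma>
    by (simp only: sentence_D_def sat.simps(5,9) start main history_inst_iff fun_upd_same)
  then show ?thesis
    using history_imp_halts halts_imp_history unfolding true_in_def by blast
qed

lemma true_sentence_B:
  assumes "set rs = R"
  shows "true_in struct_B (sentence_B n rs) \<longleftrightarrow> halts n"
proof -
  have main: "sat struct_B \<sigma> (BAll 1 (Var 0) (matrix_B rs)) \<longleftrightarrow>
      (\<forall>\<rho>\<in>R. \<forall>m. sublist (replicate m False) (\<sigma> 0) \<longrightarrow>
        sublist (conf (inst (fst \<rho>) m) @ [True]) (\<sigma> 0) \<longrightarrow>
        sublist (conf (inst (snd \<rho>) m) @ [True]) (\<sigma> 0))" for \<sigma>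
    unfolding sat.simps sat_matrix_B assms
    by (simp add: struct_B_def bits_structure_simps) blast
  have start: "sat struct_B \<sigma> (Le (start_trm n) (Var 0)) \<longleftrightarrow>
      sublist (conf (0, 2 ^ n) @ [True]) (\<sigma> 0)" for \<sigma>
    by (simp add: struct_B_def trm_val_start bits_structure_simps del: conf.simps)
  have "sat struct_B \<sigma> (sentence_B n rs) \<longleftrightarrow> (\<exists>u. closed_word n u)" for \<sigma>
    by (simp only: sentence_B_def sat.simps(5,9) start main closed_word_inst_iff fun_upd_same)
  then show ?thesis
    using closed_word_imp_halts halts_imp_history unfolding true_in_def by blast
qed

lemma true_sentence_F:
  assumes "set rs = R"
  shows "true_in struct_F (sentence_F n h rs) \<longleftrightarrow> halts n"
proof -
  have body: "(\<exists>w. length w \<le> length (\<sigma> 0) \<and> (\<exists>y. length y \<le> length (\<sigma> 0) \<and>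
        sat struct_F (\<sigma>(1 := v, 2 := w, 3 := y)) (matrix_F h rs))) \<longleftrightarrow>
      (prefix (v @ [True, True]) (\<sigma> 0) \<longrightarrow>
        prefix (v @ [True, True] @ replicate (Suc h) False @ [True]) (\<sigma> 0) \<or>
        (\<exists>\<rho>\<in>R. \<exists>m. prefix (v @ conf (inst (fst \<rho>) m) @ conf (inst (snd \<rho>) m) @ [True]) (\<sigma> 0)))"
    (is "?lhs \<longleftrightarrow> ?rhs") for \<sigma> v
  proof
    assume ?lhs
    then obtain w y where "sat struct_F (\<sigma>(1 := v, 2 := w, 3 := y)) (matrix_F h rs)" by blast
    then consider "length (\<sigma> 0) < length (v @ [True, True])"
      | "w @ y = \<sigma> 0" "length w = length (v @ [True, True])" "w \<noteq> v @ [True, True]"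
      | "(v @ [True, True] @ replicate (Suc h) False @ [True]) @ y = \<sigma> 0"
      | \<rho> m where "\<rho> \<in> R"
        "(v @ conf (inst (fst \<rho>) m) @ conf (inst (snd \<rho>) m) @ [True]) @ y = \<sigma> 0"
      unfolding sat_matrix_F sat_step_F assms by (simp del: conf.simps) blast
    then show ?rhs
    proof cases
      case 1
      then show ?thesis using prefix_length_le leD by blast
    next
      case 2
      then show ?thesis by (metis append_eq_append_conv append.assoc prefix_def)
    next
      case 3
      then show ?thesis by (metis prefix_def)
    next
      case 4
      then show ?thesis by (metis prefix_def)
    qed
  next
    define u where "u = \<sigma> 0"
    assume ?rhs
    \<comment> \<open>The premise can fail in two ways: \<open>v\<close> with two ones is too long
      for \<open>u\<close>, or it fits but differs from the prefix of that length. Each has its own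
      disjunct.\<close>
    then consider "length u < length (v @ [True, True])"
      | "length (v @ [True, True]) \<le> length u" "\<not> prefix (v @ [True, True]) u"
      | "prefix (v @ [True, True] @ replicate (Suc h) False @ [True]) u"
      | \<rho> m where "\<rho> \<in> R"
        "prefix (v @ conf (inst (fst \<rho>) m) @ conf (inst (snd \<rho>) m) @ [True]) u"
      unfolding u_def by fastforce
    then show ?lhs
    proof cases
      case 1
      \<comment> \<open>The disjunct on lengths mentions neither \<open>w\<close> nor
        \<open>y\<close>; the empty word satisfies both bounds.\<close>
      then show ?thesis
        unfolding sat_matrix_F u_def by (intro exI[of _ "[]"] conjI disjI1) auto
    next
      case 2
      \<comment> \<open>\<open>w\<close> is the actual prefix of \<open>u\<close> of the length in
        question, and so a witness of the mismatch.\<close>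
      define w y where "w = take (length (v @ [True, True])) u" and "y = drop (length (v @ [True, True])) u"
      have "w @ y = u" "length w = length (v @ [True, True])" "w \<noteq> v @ [True, True]"
        using 2 take_is_prefix[of "length (v @ [True, True])" u] by (auto simp: w_def y_def)
      moreover from this(1) have "length w \<le> length u" "length y \<le> length u" by auto
      ultimately show ?thesis
        unfolding sat_matrix_F u_def[symmetric] 
        by - (rule exI[of _ w], intro conjI exI[of _ y], auto simp: u_def[symmetric])
    next
      case 3
      then obtain y where "u = (v @ [True, True] @ replicate (Suc h) False @ [True]) @ y"
        unfolding prefix_def by blast
      then show ?thesis
        unfolding sat_matrix_F u_def[symmetric] 
        by - (rule exI[of _ "[]"], intro conjI exI[of _ y], auto simp: u_def[symmetric])
    next
      case 4
      then obtain y where y: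
        "u = (v @ conf (inst (fst \<rho>) m) @ conf (inst (snd \<rho>) m) @ [True]) @ y"
        unfolding prefix_def by blast
      obtain q k j where \<rho>: "fst \<rho> = (q, k, j)" by (cases "fst \<rho>") auto
      \<comment> \<open>The block must also be no longer than \<open>u\<close>. Since k is positive,
        it is at most as long as the last block of the matched configuration.\<close>
      have "m \<le> k * m"
        using coeff_pos[of q k j "snd \<rho>"] 4(1) \<rho> by (cases \<rho>) auto
      also have "k * m \<le> length u" unfolding y \<rho> inst_def by simp
      finally have "m \<le> length u" .
      with y 4(1) show ?thesis
        unfolding sat_matrix_F sat_step_F u_def[symmetric] assms
        by - (rule exI[of _ "replicate m False"], intro conjI exI[of _ y] disjI2 bexI[of _ \<rho>],
            auto simp: u_def[symmetric] simp del: conf.simps)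
    qed
  qed
  have main: "sat struct_F \<sigma> (BAll 1 (Var 0) (BEx 2 (Var 0) (BEx 3 (Var 0) (matrix_F h rs)))) \<longleftrightarrow>
      (\<forall>v. prefix (v @ [True, True]) (\<sigma> 0) \<longrightarrow>
        prefix (v @ [True, True] @ replicate (Suc h) False @ [True]) (\<sigma> 0) \<or>
        (\<exists>\<rho>\<in>R. \<exists>m. prefix (v @ conf (inst (fst \<rho>) m) @ conf (inst (snd \<rho>) m) @ [True]) (\<sigma> 0)))"
    (is "_ \<longleftrightarrow> (\<forall>v. ?P v)") for \<sigma>
  proof -
    have "sat struct_F \<sigma> (BAll 1 (Var 0) (BEx 2 (Var 0) (BEx 3 (Var 0) (matrix_F h rs)))) \<longleftrightarrow>
        (\<forall>v. length v \<le> length (\<sigma> 0) \<longrightarrow> ?P v)"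
      using body[of \<sigma>] by (simp add: struct_F_def bits_structure_simps)
    also have "\<dots> \<longleftrightarrow> (\<forall>v. ?P v)"
      by (metis append_prefixD prefix_length_le)
    finally show ?thesis .
  qed
  have start: "sat struct_F \<sigma> (BEx 1 (Var 0) (Eq (Conc (start_trm n) (Var 1)) (Var 0))) \<longleftrightarrow>
      prefix (conf (0, 2 ^ n) @ [True]) (\<sigma> 0)" for \<sigma>
    by (auto simp: struct_F_def trm_val_start bits_structure_simps prefix_def simp del: conf.simps; metis)
  have dummy: "sat struct_F \<sigma> (BAll 1 ConstE (Eq ConstE ConstE))" for \<sigma>
    by simp
  have "sat struct_F \<sigma> (sentence_F n h rs) \<longleftrightarrow> (\<exists>u. history n u)" for \<sigma>
    by (simp only: sentence_F_def sat.simps(5,9) start main dummy history_inst_iff fun_upd_same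
        simp_thms)
  then show ?thesis
    using history_imp_halts halts_imp_history unfolding true_in_def by blast
qed

end

section \<open>Combining the reductions with diagonalisation\<close>

lemma recursive_start_le: "recursive 1 (\<lambda>xs. fm_code (Le (start_trm (xs ! 0)) (Var 0)))"
  by (auto intro!: recursive_prod_encode recursive_const recursive_start_trm[simplified])

lemma recursive_start_eq:
  "recursive 1 (\<lambda>xs. fm_code (BEx 1 (Var 0) (Eq (Conc (start_trm (xs ! 0)) (Var 1)) (Var 0))))"
  by (auto intro!: recursive_prod_encode recursive_const recursive_start_trm[simplified])

text \<open>The rules and the halting state depend on \<open>f\<close> alone, so a single second
  conjunct represents halting for all inputs \<open>n\<close>.\<close>

lemma representing_rules:
  obtains R h rs where "growing_system R h" "set rs = R"
    "\<And>n. growing_system.halts R h n \<longleftrightarrow> (\<exists>z. rec_eval f [n] z)"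
  using halting_system[of f] growing_system.finite_R finite_list by metis

theorem theorem14:
  shows "undecidable_fragment 2 0 1 struct_D
       \<and> undecidable_fragment 1 0 1 struct_B
       \<and> undecidable_fragment 1 3 2 struct_F"
proof (intro conjI)
  show "undecidable_fragment 2 0 1 struct_D"
  proof (rule undecidable_fragmentI[OF recursive_start_le])
    fix d
    obtain R h rs where "growing_system R h" "set rs = R"
      "\<And>n. growing_system.halts R h n \<longleftrightarrow> (\<exists>z. rec_eval d [n] z)"
      using representing_rules by blast
    then show "\<exists>\<phi>. \<forall>n. Ex 0 (And (Le (start_trm n) (Var 0)) \<phi>) \<in> Sigma_sentences 2 0 1 \<and>
        (true_in struct_D (Ex 0 (And (Le (start_trm n) (Var 0)) \<phi>)) \<longleftrightarrow> (\<exists>z. rec_eval d [n] z))"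
      using sentences(1) growing_system.true_sentence_D unfolding sentence_D_def by metis
  qed
  show "undecidable_fragment 1 0 1 struct_B"
  proof (rule undecidable_fragmentI[OF recursive_start_le])
    fix d
    obtain R h rs where "growing_system R h" "set rs = R"
      "\<And>n. growing_system.halts R h n \<longleftrightarrow> (\<exists>z. rec_eval d [n] z)"
      using representing_rules by blast
    then show "\<exists>\<phi>. \<forall>n. Ex 0 (And (Le (start_trm n) (Var 0)) \<phi>) \<in> Sigma_sentences 1 0 1 \<and>
        (true_in struct_B (Ex 0 (And (Le (start_trm n) (Var 0)) \<phi>)) \<longleftrightarrow> (\<exists>z. rec_eval d [n] z))"
      using sentences(2) growing_system.true_sentence_B unfolding sentence_B_def by metis
  qed
  show "undecidable_fragment 1 3 2 struct_F"
  proof (rule undecidable_fragmentI[OF recursive_start_eq])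
    fix d
    obtain R h rs where "growing_system R h" "set rs = R"
      "\<And>n. growing_system.halts R h n \<longleftrightarrow> (\<exists>z. rec_eval d [n] z)"
      using representing_rules by blast
    then show "\<exists>\<phi>. \<forall>n. Ex 0 (And (BEx 1 (Var 0) (Eq (Conc (start_trm n) (Var 1)) (Var 0))) \<phi>)
          \<in> Sigma_sentences 1 3 2 \<and>
        (true_in struct_F (Ex 0 (And (BEx 1 (Var 0) (Eq (Conc (start_trm n) (Var 1)) (Var 0))) \<phi>)) \<longleftrightarrow>
          (\<exists>z. rec_eval d [n] z))"
      using sentences(3) growing_system.true_sentence_F unfolding sentence_F_def by metis
  qed
qed

end
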